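(* Let $n$ be an integer. There exist a convex polytope $Q\subset\mathbb{R}^3$ and a shortest path $P$ between two points on the boundary of $Q$ such that the spiralling number of $P$ satisfies $s(P)\ge n$.
   Context: A shortest path between two points $a,b\in\mathrm{bd}\,Q$ is a path contained in $\mathrm{bd}\,Q$ from $a$ to $b$ whose length is minimal among all such paths. The spiralling number $s(P)$ of a path $P$ from $a$ to $b$ on the polytopal surface $\mathrm{bd}\,Q$ is defined as follows: for a variable point $x\in P\setminus\{a,b\}$, write $x$ in cylindrical coordinates as $(2\pi\phi(x),r(x),z(x))$, where the $z$-axis is the line through $a$ and $b$, $2\pi\phi(x)$ is the angular coordinate, and $\phi$ is chosen to be a continuous real-valued function on $P\setminus\{a,b\}$. Then $$s(P)=\lim_{x\to a,\;y\to b}|\phi(x)-\phi(y)|,$$ where $x,y\in P\setminus\{a,b\}$. (It measures how many times $P$ winds around the line through $a$ and $b$.) *)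

theory Defs
  imports "HOL-Analysis.Analysis"
begin

text \<open>Length of a parametrised curve: the supremum of the lengths of inscribed polygons.
  The value is infinite exactly for non-rectifiable curves.\<close>

definition path_length :: "(real \<Rightarrow> 'a::metric_space) \<Rightarrow> ennreal" where
  "path_length g =
     (SUP ts \<in> {ts. sorted ts \<and> set ts \<subseteq> {0..1}}.
        \<Sum>i<length ts - 1. ennreal (dist (g (ts ! i)) (g (ts ! Suc i))))"

definition shortest_path_in :: "'a::metric_space set \<Rightarrow> (real \<Rightarrow> 'a) \<Rightarrow> bool" where
  "shortest_path_in S g \<longleftrightarrow>
     path g \<and> path_image g \<subseteq> S \<and>
     (\<forall>h. path h \<and> path_image h \<subseteq> S \<and> pathstart h = pathstart g \<and> pathfinish h = pathfinish g
        \<longrightarrow> path_length g \<le> path_length h)"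

definition orthonormal_frame :: "real^3 \<Rightarrow> real^3 \<Rightarrow> real^3 \<Rightarrow> bool" where
  "orthonormal_frame u v w \<longleftrightarrow>
     norm u = 1 \<and> norm v = 1 \<and> norm w = 1 \<and> u \<bullet> v = 0 \<and> u \<bullet> w = 0 \<and> v \<bullet> w = 0"

text \<open>\<open>x\<close> has cylindrical coordinates \<open>(\<theta>, r, z)\<close> with respect to the origin \<open>c\<close>, the
  \<open>z\<close>-axis through \<open>c\<close> in direction \<open>w\<close>, and the direction \<open>u\<close> of angle \<open>0\<close>. Requiring
  \<open>r > 0\<close> excludes the points of the axis, at which the angle is not determined.\<close>

definition cylindrical_coords ::
  "real^3 \<Rightarrow> real^3 \<Rightarrow> real^3 \<Rightarrow> real^3 \<Rightarrow> real^3 \<Rightarrow> real \<Rightarrow> real \<Rightarrow> real \<Rightarrow> bool" where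
  "cylindrical_coords c u v w x \<theta> r z \<longleftrightarrow>
     r > 0 \<and> x = c + (r * cos \<theta>) *\<^sub>R u + (r * sin \<theta>) *\<^sub>R v + z *\<^sub>R w"

text \<open>\<open>has_spiralling_number g s\<close>: the spiralling number of the path \<open>g\<close> is defined and equal
  to \<open>s\<close>. The angle is measured in full turns, by a continuous real-valued function
  \<open>\<phi>\<close> on the point set of \<open>g\<close> without its endpoints; in particular that set avoids the line
  through the endpoints. The value does not depend on the choice of \<open>u\<close> and \<open>v\<close>, since another
  choice changes \<open>\<phi>\<close> only by its sign and an additive constant.\<close>

definition has_spiralling_number :: "(real \<Rightarrow> real^3) \<Rightarrow> real \<Rightarrow> bool" where
  "has_spiralling_number g s \<longleftrightarrow>
     (let a = pathstart g; b = pathfinish g; P = path_image g - {a, b} in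
       a \<noteq> b \<and>
       (\<exists>u v \<phi> r z.
          orthonormal_frame u v (sgn (b - a)) \<and>
          continuous_on P \<phi> \<and>
          (\<forall>x\<in>P. cylindrical_coords a u v (sgn (b - a)) x (2 * pi * \<phi> x) (r x) (z x)) \<and>
          ((\<lambda>(x, y). \<bar>\<phi> x - \<phi> y\<bar>) \<longlongrightarrow> s) ((at a within P) \<times>\<^sub>F (at b within P))))"

end

theory Submission
  imports Defs "HOL-Complex_Analysis.Great_Picard"
begin

text \<open>The polytope is a long needle with axis from \<open>foot\<close> to \<open>tip\<close> and vertices at height
  \<open>M ^ (2 * k)\<close> and distance \<open>M ^ k\<close> from the axis, each turned by a quarter turn
  against the previous one, where \<open>M\<close> is huge. On the side away from the nearest vertex
  the needle is very thin, and a string that follows this side winds around the axis along with the vertices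
  while it exceeds the length of the axis by only \<open>O(1 / M ^ 3)\<close> per vertex. A curve that
  crosses the polygonal line of the vertices on the outside is longer than the axis by at least
  \<open>1 / (6 * M)\<close>. So a shortest path cannot cross the rays from the axis through this line, and
  its angle has to follow the angle of the line up to a full turn. Near the two end vertices, where
  the needle is a cone, a shortest path is a segment, which makes the limit exist.\<close>

section \<open>Curves of bounded length\<close>

text \<open>Leaving the axis by r at height z costs about r^2 / (2 * z). The vertices lie on the
  paraboloid r^2 = z, so this cost has the same order at every level. Along the edge between two
  consecutive vertices r^2 / z is smallest at the geometric mean of their heights, where it still
  exceeds 1 / (2 * M); this is the source of the barrier 1 / (6 * M). Quarter turns make consecutive
  vertices orthogonal, so a plane facing away from vertex k is obstructed only by vertices at least
  two steps off. Those below are smaller than M^k by a factor of at least M^2, and a slight tilt of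
  the plane clears those above. Hence the thin side has r^2 / z of order 1 / M^3. The obstacle is
  that the shortest path cannot be written down. Compactness yields a minimal curve, about which
  only two facts enter: its length is below the barrier, and it is straight wherever the frontier
  contains the segment to an end point. A lower bound for the winding follows from the barrier
  alone, up to one full turn.\<close>

definition short_curve :: "'a::metric_space set \<Rightarrow> real \<Rightarrow> 'a \<Rightarrow> 'a \<Rightarrow> (real \<Rightarrow> 'a) \<Rightarrow> bool" where
  "short_curve S l p q f \<longleftrightarrow>
     0 \<le> l \<and> 1-lipschitz_on {0..l} f \<and> f ` {0..l} \<subseteq> S \<and> f 0 = p \<and> f l = q"

text \<open>The number \<open>l\<close> is only an upper bound for the length, since a 1-Lipschitz
  curve may move slower than unit speed. Such curves survive uniform limits, concatenation and
  nonexpansive maps, so lengths themselves rarely have to be computed.\<close>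

definition joined_within :: "'a::metric_space set \<Rightarrow> real \<Rightarrow> 'a \<Rightarrow> 'a \<Rightarrow> bool" where
  "joined_within S l p q \<longleftrightarrow> (\<exists>f. short_curve S l p q f)"

lemma short_curve_dist:
  assumes "short_curve S l p q f" "s \<in> {0..l}" "t \<in> {0..l}"
  shows "dist (f s) (f t) \<le> \<bar>s - t\<bar>"
  using assms lipschitz_onD[of 1 "{0..l}" f s t] by (simp add: short_curve_def dist_real_def)

lemma short_curve_in: "short_curve S l p q f \<Longrightarrow> t \<in> {0..l} \<Longrightarrow> f t \<in> S"
  by (auto simp: short_curve_def)

lemma short_curve_ends:
  assumes "short_curve S l p q f"
  shows "0 \<le> l" "f 0 = p" "f l = q"
  using assms by (auto simp: short_curve_def)

lemma short_curve_continuous: "short_curve S l p q f \<Longrightarrow> continuous_on {0..l} f"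
  by (auto simp: short_curve_def intro: lipschitz_on_continuous_on)

lemma short_curveI:
  assumes "0 \<le> l" "\<And>s t. 0 \<le> s \<Longrightarrow> s < t \<Longrightarrow> t \<le> l \<Longrightarrow> dist (f s) (f t) \<le> t - s"
    "\<And>t. 0 \<le> t \<Longrightarrow> t \<le> l \<Longrightarrow> f t \<in> S" "f 0 = p" "f l = q"
  shows "short_curve S l p q f"
proof -
  have "1-lipschitz_on {0..l} f"
  proof (rule lipschitz_on_leI)
    fix s t assume "s \<in> {0..l}" "t \<in> {0..l}" "s \<le> t"
    then show "dist (f s) (f t) \<le> 1 * dist s t"
      using assms(2)[of s t] by (cases "s = t") (auto simp: dist_real_def)
  qed simp
  then show ?thesis using assms by (auto simp: short_curve_def)
qed

lemma short_curve_piece: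
  assumes "short_curve S l p q f" "0 \<le> s" "s \<le> t" "t \<le> l"
  shows "short_curve S (t - s) (f s) (f t) (\<lambda>x. f (s + x))"
proof (rule short_curveI)
  fix x y assume "0 \<le> x" "x < y" "y \<le> t - s"
  then show "dist (f (s + x)) (f (s + y)) \<le> y - x"
    using short_curve_dist[OF assms(1), of "s + x" "s + y"] assms(2-) by simp
qed (use assms(2-) short_curve_in[OF assms(1), of "s + _"] in auto)

lemma short_curve_reverse:
  assumes "short_curve S l p q f"
  shows "short_curve S l q p (\<lambda>x. f (l - x))"
proof (rule short_curveI)
  fix x y assume "0 \<le> x" "x < y" "y \<le> l"
  then show "dist (f (l - x)) (f (l - y)) \<le> y - x"
    using short_curve_dist[OF assms(1), of "l - x" "l - y"] by simp
qed (use short_curve_in[OF assms(1), of "l - _"] short_curve_ends[OF assms(1)] in auto)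

lemma joined_within_reverse: "joined_within S l p q \<Longrightarrow> joined_within S l q p"
  unfolding joined_within_def using short_curve_reverse by blast

lemma joined_within_trans:
  assumes "joined_within S l p q" "joined_within S m q r"
  shows "joined_within S (l + m) p r"
proof -
  obtain f g where f: "short_curve S l p q f" and g: "short_curve S m q r g"
    using assms by (auto simp: joined_within_def)
  note ef = short_curve_ends[OF f] and eg = short_curve_ends[OF g]
  define h where "h x = (if x \<le> l then f x else g (x - l))" for x
  have "short_curve S (l + m) p r h"
  proof (rule short_curveI)
    fix s t assume st: "0 \<le> s" "s < t" "t \<le> l + m"
    consider "t \<le> l" | "l < s" | "s \<le> l" "l < t" by linarith
    then show "dist (h s) (h t) \<le> t - s"
    proof cases
      case 1 then show ?thesis using short_curve_dist[OF f, of s t] st by (auto simp: h_def)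
    next
      case 2 then show ?thesis using short_curve_dist[OF g, of "s - l" "t - l"] st by (auto simp: h_def)
    next
      case 3
      have "dist (f s) q \<le> l - s" using short_curve_dist[OF f, of s l] st 3 ef by auto
      moreover have "dist q (g (t - l)) \<le> t - l"
        using short_curve_dist[OF g, of 0 "t - l"] st 3 eg by auto
      ultimately have "dist (f s) (g (t - l)) \<le> t - s" by metric
      then show ?thesis using 3 by (auto simp: h_def)
    qed
  qed (use ef eg short_curve_in[OF f] short_curve_in[OF g] in \<open>auto simp: h_def\<close>)
  then show ?thesis by (auto simp: joined_within_def)
qed

lemma joined_within_mono:
  assumes "joined_within S l p q" "l \<le> m"
  shows "joined_within S m p q"
proof -
  obtain f where f: "short_curve S l p q f" using assms by (auto simp: joined_within_def)
  note ef = short_curve_ends[OF f]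
  have "short_curve S (m - l) q q (\<lambda>_. q)"
    by (rule short_curveI) (use ef assms short_curve_in[OF f, of l] in auto)
  then have "joined_within S (m - l) q q" unfolding joined_within_def by blast
  then have "joined_within S (l + (m - l)) p q" by (rule joined_within_trans[OF assms(1)])
  then show ?thesis by simp
qed

lemma joined_within_segment:
  fixes p q :: "'a::real_normed_vector"
  assumes "closed_segment p q \<subseteq> S"
  shows "joined_within S (dist p q) p q"
proof (cases "p = q")
  case True
  have "short_curve S 0 p p (\<lambda>_. p)" by (rule short_curveI) (use assms True in auto)
  then show ?thesis using True by (auto simp: joined_within_def)
next
  case False
  define d where "d = dist p q"
  have d: "d > 0" using False by (simp add: d_def)
  have "short_curve S d p q (\<lambda>t. p + (t / d) *\<^sub>R (q - p))"
  proof (rule short_curveI)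
    fix s t assume "0 \<le> s" "s < t" "t \<le> d"
    have "dist (p + (s / d) *\<^sub>R (q - p)) (p + (t / d) *\<^sub>R (q - p)) = norm ((s / d - t / d) *\<^sub>R (q - p))"
      by (simp add: dist_norm algebra_simps)
    also have "\<dots> = \<bar>(s - t) / d\<bar> * d"
      unfolding norm_scaleR d_def by (simp add: dist_norm norm_minus_commute diff_divide_distrib)
    also have "\<dots> = t - s" using \<open>s < t\<close> d by (simp add: abs_mult)
    finally show "dist (p + (s / d) *\<^sub>R (q - p)) (p + (t / d) *\<^sub>R (q - p)) \<le> t - s" by simp
  next
    fix t assume "0 \<le> t" "t \<le> d"
    then show "p + (t / d) *\<^sub>R (q - p) \<in> S"
      using assms d unfolding closed_segment_def
      by (intro subsetD[OF assms[unfolded closed_segment_def]] CollectI exI[of _ "t / d"])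
         (auto simp: algebra_simps)
  qed (use d in auto)
  then show ?thesis by (auto simp: joined_within_def d_def)
qed

section \<open>Length of paths and reparametrisation by arc length\<close>

lemma inscribed_polygon_length_le:
  fixes g :: "real \<Rightarrow> 'a::metric_space"
  assumes "\<And>s t. s \<in> {0..1} \<Longrightarrow> t \<in> {0..1} \<Longrightarrow> s \<le> t \<Longrightarrow> dist (g s) (g t) \<le> l * (t - s)"
    and "0 \<le> l" "sorted ts" "set ts \<subseteq> {0..1}"
  shows "(\<Sum>i<length ts - 1. dist (g (ts ! i)) (g (ts ! Suc i))) \<le> l"
proof (cases "ts = []")
  case False
  have "(\<Sum>i<length ts - 1. dist (g (ts ! i)) (g (ts ! Suc i)))
      \<le> (\<Sum>i<length ts - 1. l * (ts ! Suc i - ts ! i))"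
  proof (rule sum_mono)
    fix i assume "i \<in> {..<length ts - 1}"
    then have "ts ! i \<in> set ts" "ts ! Suc i \<in> set ts" "ts ! i \<le> ts ! Suc i"
      using assms(3) by (auto simp: sorted_nth_mono)
    then show "dist (g (ts ! i)) (g (ts ! Suc i)) \<le> l * (ts ! Suc i - ts ! i)"
      using assms by blast
  qed
  also have "\<dots> = l * (ts ! (length ts - 1) - ts ! 0)"
    by (simp add: sum_distrib_left[symmetric] sum_lessThan_telescope)
  also have "\<dots> \<le> l * 1"
  proof (rule mult_left_mono)
    have "ts ! (length ts - 1) \<in> {0..1}" "ts ! 0 \<in> {0..1}"
      using False assms(4) by (force simp: subset_iff)+
    then show "ts ! (length ts - 1) - ts ! 0 \<le> 1" by auto
  qed (use assms in auto)
  finally show ?thesis by simp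
qed (use assms in auto)

lemma short_curve_path:
  assumes f: "short_curve S l p q f"
  defines "g \<equiv> \<lambda>t. f (l * t)"
  shows "path g" "path_image g = f ` {0..l}" "path_length g \<le> ennreal l"
    "pathstart g = p" "pathfinish g = q"
proof -
  note ef = short_curve_ends[OF f]
  have sub: "l * t \<in> {0..l}" if "t \<in> {0..1}" for t
    using that ef by (auto simp: mult_left_le)
  show "path g" unfolding path_def g_def
    by (intro continuous_on_compose2[OF short_curve_continuous[OF f]] continuous_intros)
       (use sub in auto)
  have "(\<lambda>t. l * t) ` {0..1} = {0..l}"
    using image_mult_atLeastAtMost_if[of l 0 1] ef by (auto split: if_splits)
  then show "path_image g = f ` {0..l}" unfolding path_image_def g_def
    by (metis image_image)
  show "pathstart g = p" "pathfinish g = q" using ef by (auto simp: g_def pathstart_def pathfinish_def)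
  show "path_length g \<le> ennreal l" unfolding path_length_def
  proof (rule SUP_least)
    fix ts :: "real list" assume ts: "ts \<in> {ts. sorted ts \<and> set ts \<subseteq> {0..1}}"
    have "(\<Sum>i<length ts - 1. dist (g (ts ! i)) (g (ts ! Suc i))) \<le> l"
    proof (rule inscribed_polygon_length_le)
      fix s t :: real assume "s \<in> {0..1}" "t \<in> {0..1}" "s \<le> t"
      then show "dist (g s) (g t) \<le> l * (t - s)"
        using short_curve_dist[OF f sub sub, of s t] ef mult_left_mono[of s t l]
        by (auto simp: g_def right_diff_distrib)
    qed (use ts ef in auto)
    then show "(\<Sum>i<length ts - 1. ennreal (dist (g (ts ! i)) (g (ts ! Suc i)))) \<le> ennreal l"
      by (simp add: sum_ennreal ennreal_leI)
  qed
qed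

text \<open>Reparametrisation by arc length: \<open>V t\<close> is the length of \<open>h\<close> up
  to time \<open>t\<close>, and \<open>T\<close> is a generalised inverse of \<open>V\<close>.
  Continuity of \<open>V\<close> is avoided; continuity of \<open>h\<close> takes its place.\<close>

lemma joined_within_path_length:
  fixes h :: "real \<Rightarrow> 'a::metric_space"
  assumes h: "path h" "path_image h \<subseteq> S" and len: "path_length h \<le> ennreal l" and l: "0 \<le> l"
  shows "joined_within S l (pathstart h) (pathfinish h)"
proof -
  define poly where "poly ts = (\<Sum>i<length ts - 1. dist (h (ts ! i)) (h (ts ! Suc i)))" for ts
  define A where "A t = {ts::real list. sorted ts \<and> set ts \<subseteq> {0..t}}" for t
  define V where "V t = (SUP ts\<in>A t. poly ts)" for t
  have A_mono: "A s \<subseteq> A t" if "s \<le> t" for s t using that by (force simp: A_def)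
  have A_ne: "[] \<in> A t" for t by (auto simp: A_def)
  have poly_le: "poly ts \<le> l" if "ts \<in> A t" "t \<le> 1" for ts t
  proof -
    have "ennreal (poly ts) = (\<Sum>i<length ts - 1. ennreal (dist (h (ts ! i)) (h (ts ! Suc i))))"
      by (simp add: poly_def sum_ennreal)
    also have "\<dots> \<le> path_length h" unfolding path_length_def
      by (rule SUP_upper) (use that A_mono[of t 1] in \<open>auto simp: A_def\<close>)
    finally have "ennreal (poly ts) \<le> ennreal l" using len by simp
    then show ?thesis using l by simp
  qed
  have bdd: "bdd_above (poly ` A t)" if "t \<le> 1" for t
    using poly_le that by (intro bdd_aboveI2) auto
  have V_nonneg: "0 \<le> V t" if "t \<le> 1" for t
    unfolding V_def using cSUP_upper[OF A_ne bdd[OF that]] by (simp add: poly_def)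
  have V_le: "V t \<le> l" if "t \<le> 1" for t
    unfolding V_def using A_ne poly_le that by (intro cSUP_least) auto
  have poly_snoc: "poly (ts @ [x]) \<ge> poly ts" for ts x
  proof (cases "ts = []")
    case False
    then obtain m where m: "length ts = Suc m" by (cases ts) auto
    show ?thesis unfolding poly_def using m
      by (auto simp: nth_append intro!: sum_nonneg)
  qed (auto simp: poly_def)
  have poly_snoc2: "poly (ts @ [x, y]) = poly (ts @ [x]) + dist (h x) (h y)" for ts x y
    unfolding poly_def by (auto simp: nth_append intro!: sum.cong)
  have V_add: "V s + dist (h s) (h t) \<le> V t" if "0 \<le> s" "s \<le> t" "t \<le> 1" for s t
  proof -
    have "V s \<le> V t - dist (h s) (h t)" unfolding V_def[of s]
    proof (rule cSUP_least)
      show "A s \<noteq> {}" using A_ne by auto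
      fix ts assume "ts \<in> A s"
      then have "ts @ [s, t] \<in> A t" using that by (force simp: A_def sorted_append)
      then have "poly (ts @ [s, t]) \<le> V t" unfolding V_def
        using bdd[OF that(3)] by (intro cSUP_upper) auto
      then show "poly ts \<le> V t - dist (h s) (h t)"
        using poly_snoc[of ts s] poly_snoc2[of ts s t] by linarith
    qed
    then show ?thesis by simp
  qed
  have V_mono: "V s \<le> V t" if "0 \<le> s" "s \<le> t" "t \<le> 1" for s t
    using V_add[OF that] zero_le_dist[of "h s" "h t"] by linarith
  have V0: "V 0 = 0"
  proof -
    have "poly ts \<le> 0" if "ts \<in> A 0" for ts
    proof -
      have z: "ts ! i = 0" if "i < length ts" for i
        using \<open>ts \<in> A 0\<close> nth_mem[OF that] by (auto simp: A_def)
      have "poly ts = (\<Sum>i<length ts - 1. 0)" unfolding poly_def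
        by (rule sum.cong) (auto simp: z)
      then show ?thesis by simp
    qed
    then have "V 0 \<le> 0" unfolding V_def using A_ne by (intro cSUP_least) auto
    then show ?thesis using V_nonneg[of 0] by simp
  qed
  have cont: "continuous_on {0..1} h" using h by (simp add: path_def)
  \<comment> \<open>\<open>V\<close> is constant where \<open>h\<close> pauses, so it may have no
    inverse. The supremum of a sublevel set picks the last moment of such a pause.\<close>
  define B where "B s = {t\<in>{0..1}. V t \<le> s}" for s
  define T where "T s = Sup (B s)" for s
  have B0: "0 \<in> B s" if "0 \<le> s" for s using that V0 by (simp add: B_def)
  have B_bdd: "bdd_above (B s)" for s by (rule bdd_aboveI[of _ 1]) (auto simp: B_def)
  have T_ge: "t \<le> T s" if "t \<in> B s" for s t unfolding T_def using that B_bdd by (rule cSup_upper)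
  have T01: "T s \<in> {0..1}" if "0 \<le> s" for s
  proof -
    have "B s \<noteq> {}" using B0[OF that] by blast
    then have "T s \<le> 1" unfolding T_def by (rule cSup_least) (simp add: B_def)
    then show ?thesis using T_ge[OF B0[OF that]] by simp
  qed
  have T_mono: "T s \<le> T t" if "0 \<le> s" "s \<le> t" for s t
    unfolding T_def
  proof (rule cSup_subset_mono)
    show "B s \<noteq> {}" using B0[OF that(1)] by blast
    show "B s \<subseteq> B t" using that(2) by (auto simp: B_def)
  qed (rule B_bdd)
  have key: "dist (h (T s)) (h (T t)) \<le> t - s" if st: "0 \<le> s" "s < t" for s t
  proof (cases "T s = T t")
    case False
    then have lt: "T s < T t" using T_mono[of s t] st by auto
    \<comment> \<open>Just right of \<open>T s\<close> the value of \<open>V\<close> exceeds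
      \<open>s\<close>, and just left of \<open>T t\<close> it is at most \<open>t\<close>; at
      \<open>T s\<close> and \<open>T t\<close> themselves neither is known. Denominators of at
      least 3 keep \<open>x n\<close> to the left of \<open>y n\<close>.\<close>
    define e where "e n = (T t - T s) / (real n + 3)" for n
    define x where "x n = T s + e n" for n
    define y where "y n = T t - e n" for n
    have xy: "T s < x n" "x n \<le> y n" "y n < T t" for n
    proof -
      have "e n > 0" using lt by (simp add: e_def)
      moreover have "e n \<le> (T t - T s) / 2"
        unfolding e_def using lt by (intro divide_left_mono) auto
      ultimately show "T s < x n" "x n \<le> y n" "y n < T t" unfolding x_def y_def by auto
    qed
    have bd: "dist (h (x n)) (h (y n)) \<le> t - s" for n
    proof -
      have r: "0 \<le> x n" "y n \<le> 1" using T01[of s] T01[of t] xy[of n] st by auto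
      have "x n \<notin> B s" using T_ge[of "x n" s] xy[of n] by auto
      then have "s < V (x n)" using r xy[of n] by (auto simp: B_def)
      moreover obtain z where z: "z \<in> B t" "y n < z"
        using less_cSupE[of "y n" "B t"] xy[of n] B0[of t] st by (auto simp: T_def)
      then have "V (y n) \<le> t" using V_mono[of "y n" z] r xy[of n] by (auto simp: B_def)
      ultimately show ?thesis using V_add[of "x n" "y n"] r xy[of n] by linarith
    qed
    have lim0: "e \<longlonglongrightarrow> 0" unfolding e_def by real_asymp
    have xl: "x \<longlonglongrightarrow> T s" and yl: "y \<longlonglongrightarrow> T t"
      using tendsto_add[OF tendsto_const[of "T s"] lim0] tendsto_diff[OF tendsto_const[of "T t"] lim0]
      by (simp_all add: x_def[abs_def] y_def[abs_def])
    have r: "x n \<in> {0..1}" "y n \<in> {0..1}" for n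
      using T01[of s] T01[of t] xy[of n] st by auto
    have "(\<lambda>n. h (x n)) \<longlonglongrightarrow> h (T s)"
      by (rule continuous_on_tendsto_compose[OF cont xl]) (use T01[of s] st r in auto)
    moreover have "(\<lambda>n. h (y n)) \<longlonglongrightarrow> h (T t)"
      by (rule continuous_on_tendsto_compose[OF cont yl]) (use T01[of t] st r in auto)
    ultimately have "(\<lambda>n. dist (h (x n)) (h (y n))) \<longlonglongrightarrow> dist (h (T s)) (h (T t))"
      by (rule tendsto_dist)
    then show ?thesis using bd by (intro Lim_bounded[where M=0]) auto
  qed (use st in auto)
  \<comment> \<open>\<open>T 0\<close> may be positive, but \<open>h\<close> does not move while
    \<open>V\<close> is 0, and by closedness not at the supremum either.\<close>
  have start: "h (T 0) = h 0"
  proof -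
    have "closed ({0..1} \<inter> h -` {h 0})" by (rule continuous_closed_preimage[OF cont]) auto
    then have "closed {t\<in>{0..1}. h t \<in> {h 0}}" by (simp add: vimage_def Int_def)
    moreover have "B 0 \<subseteq> {t\<in>{0..1}. h t \<in> {h 0}}"
    proof
      fix t assume t: "t \<in> B 0"
      then have "dist (h 0) (h t) \<le> V t" using V_add[of 0 t] V0 by (auto simp: B_def)
      also have "V t \<le> 0" using t by (simp add: B_def)
      finally have "h t = h 0" by simp
      then show "t \<in> {t\<in>{0..1}. h t \<in> {h 0}}" using t by (auto simp: B_def)
    qed
    ultimately have "closure (B 0) \<subseteq> {t\<in>{0..1}. h t \<in> {h 0}}" by (simp add: closure_minimal)
    moreover have "T 0 \<in> closure (B 0)" unfolding T_def
      using B0[of 0] B_bdd by (intro closure_contains_Sup) auto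
    ultimately show ?thesis by auto
  qed
  have "1 \<in> B l" using V_le[of 1] by (auto simp: B_def)
  then have fin: "T l = 1" using T_ge[of 1 l] T01[OF l] by auto
  have "short_curve S l (h 0) (h 1) (\<lambda>s. h (T s))"
    by (rule short_curveI) (use l key start fin T01 h(2) in \<open>auto simp: path_image_def\<close>)
  then show ?thesis by (auto simp: joined_within_def pathstart_def pathfinish_def)
qed

section \<open>Existence of shortest curves\<close>

lemma joined_within_minimal:
  fixes S :: "'a::euclidean_space set"
  assumes S: "compact S" and ex: "joined_within S l p q"
  obtains m f where "short_curve S m p q f" "\<And>k. joined_within S k p q \<Longrightarrow> m \<le> k"
proof -
  define J where "J = {k. joined_within S k p q}"
  define m where "m = Inf J"
  have J0: "0 \<le> k" if "k \<in> J" for k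
    using that by (auto simp: J_def joined_within_def short_curve_def)
  have bdd: "bdd_below J" using J0 by (rule bdd_belowI)
  have ne: "J \<noteq> {}" using ex by (auto simp: J_def)
  have m_le: "m \<le> k" if "k \<in> J" for k unfolding m_def using that bdd by (rule cInf_lower)
  have m0: "0 \<le> m" unfolding m_def using ne J0 by (rule cInf_greatest)
  have "joined_within S (m + 1 / real (Suc n)) p q" for n
  proof -
    obtain k where "k \<in> J" "k < m + 1 / real (Suc n)"
      using cInf_lessD[OF ne, of "m + 1 / real (Suc n)"] by (auto simp: m_def)
    then show ?thesis using joined_within_mono by (force simp: J_def)
  qed
  \<comment> \<open>A minimising sequence. Its members reach \<open>q\<close> only after time
    \<open>m\<close>, but at time \<open>m\<close> they are within 1 / (n + 1) of it, so an
    Arzela-Ascoli limit on \<open>{0..m}\<close> still ends at \<open>q\<close>.\<close>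
  then obtain F where F: "\<And>n. short_curve S (m + 1 / real (Suc n)) p q (F n)"
    unfolding joined_within_def by metis
  have in_range: "t \<in> {0..m + 1 / real (Suc n)}" if "t \<in> {0..m}" for t n
    using that by (auto intro: add_increasing2)
  obtain R where R: "\<And>x. x \<in> S \<Longrightarrow> norm x \<le> R"
    using compact_imp_bounded[OF S] by (auto simp: bounded_iff)
  obtain g and r :: "nat \<Rightarrow> nat" where g: "strict_mono r"
    and lim: "\<And>e. 0 < e \<Longrightarrow> \<exists>N. \<forall>n x. N \<le> n \<and> x \<in> {0..m} \<longrightarrow> norm (F (r n) x - g x) < e"
  proof (rule Arzela_Ascoli[of "{0..m}" F R])
    show "norm (F n x) \<le> R" if "x \<in> {0..m}" for n x
      using R short_curve_in[OF F in_range[OF that]] by auto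
    show "\<exists>d>0. \<forall>n y. y \<in> {0..m} \<and> norm (x - y) < d \<longrightarrow> norm (F n x - F n y) < e"
      if "x \<in> {0..m}" "0 < e" for x e
    proof (intro exI[of _ e] conjI allI impI)
      fix n y assume "y \<in> {0..m} \<and> norm (x - y) < e"
      then show "norm (F n x - F n y) < e"
        using short_curve_dist[OF F in_range in_range, of x y n] that by (auto simp: dist_norm)
    qed (use that in auto)
    show "compact {0..m}" by simp
  qed (blast intro: that)
  have ptw: "(\<lambda>n. F (r n) x) \<longlonglongrightarrow> g x" if "x \<in> {0..m}" for x
    unfolding LIMSEQ_def dist_norm using lim that by meson
  have "short_curve S m p q g"
  proof (rule short_curveI[OF m0])
    fix s t assume st: "0 \<le> s" "s < t" "t \<le> m"
    have "(\<lambda>n. dist (F (r n) s) (F (r n) t)) \<longlonglongrightarrow> dist (g s) (g t)"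
      using st by (intro tendsto_dist ptw) auto
    then show "dist (g s) (g t) \<le> t - s"
    proof (rule Lim_bounded[where M=0], intro allI impI)
      fix n show "dist (F (r n) s) (F (r n) t) \<le> t - s"
        using short_curve_dist[OF F in_range in_range, of s t "r n"] st by auto
    qed
  next
    fix t assume "0 \<le> t" "t \<le> m"
    then show "g t \<in> S"
      using short_curve_in[OF F in_range, of t "r _"]
      by (intro closed_sequentially[OF compact_imp_closed[OF S] _ ptw]) auto
  next
    have "(\<lambda>n. F (r n) 0) \<longlonglongrightarrow> p" using short_curve_ends(2)[OF F] by simp
    then show "g 0 = p" using ptw[of 0] m0 LIMSEQ_unique by auto
  next
    have "(\<lambda>n. dist (F (r n) m) q) \<longlonglongrightarrow> 0"
    proof (rule tendsto_sandwich[OF _ _ tendsto_const])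
      have "dist (F (r n) m) q \<le> 1 / real (Suc (r n))" for n
        using short_curve_dist[OF F, of m "r n" "m + 1 / real (Suc (r n))"] in_range[of m "r n"] m0
          short_curve_ends(3)[OF F, of "r n"] by auto
      then show "\<forall>\<^sub>F n in sequentially. dist (F (r n) m) q \<le> 1 / real (Suc (r n))" by simp
      have "(\<lambda>n. 1 / real (Suc n)) \<longlonglongrightarrow> 0" by real_asymp
      then show "(\<lambda>n. 1 / real (Suc (r n))) \<longlonglongrightarrow> 0"
        using LIMSEQ_subseq_LIMSEQ[OF _ g] by (force simp: o_def)
    qed auto
    then have "(\<lambda>n. F (r n) m) \<longlonglongrightarrow> q" by (subst tendsto_dist_iff)
    then show "g m = q" using ptw[of m] m0 LIMSEQ_unique by auto
  qed
  then show ?thesis using that m_le by (auto simp: J_def)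
qed

text \<open>A competitor of finite length is reparametrised into a 1-Lipschitz curve and falls under
  \<open>min\<close>; one of infinite length is no competition.\<close>

lemma shortest_path_in_minimal_short_curve:
  assumes f: "short_curve S l p q f" and min: "\<And>k. joined_within S k p q \<Longrightarrow> l \<le> k"
  shows "shortest_path_in S (\<lambda>t. f (l * t))"
  unfolding shortest_path_in_def
proof (intro conjI allI impI)
  note sp = short_curve_path[OF f]
  show "path (\<lambda>t. f (l * t))" by (rule sp)
  show "path_image (\<lambda>t. f (l * t)) \<subseteq> S" unfolding sp using f by (auto simp: short_curve_def)
  fix h assume h: "path h \<and> path_image h \<subseteq> S \<and> pathstart h = pathstart (\<lambda>t. f (l * t)) \<and>
     pathfinish h = pathfinish (\<lambda>t. f (l * t))"
  show "path_length (\<lambda>t. f (l * t)) \<le> path_length h"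
  proof (cases "path_length h")
    case (real k)
    then have "joined_within S k p q"
      using joined_within_path_length[of h S k] h unfolding sp by auto
    then show ?thesis using sp(3) min real by (metis ennreal_leI order_trans)
  qed auto
qed

section \<open>Where a shortest curve is straight\<close>

lemma short_curve_straight:
  fixes f :: "real \<Rightarrow> 'a::euclidean_space"
  assumes f: "short_curve S l p q f" and t: "0 < t" "t \<le> l" and eq: "dist p (f t) = t"
    and s: "0 \<le> s" "s \<le> t"
  shows "f s = p + (s / t) *\<^sub>R (f t - p)"
proof -
  note ef = short_curve_ends[OF f]
  have 1: "dist p (f s) \<le> s" using short_curve_dist[OF f, of 0 s] ef s t by auto
  have 2: "dist (f s) (f t) \<le> t - s" using short_curve_dist[OF f, of s t] s t by auto
  have tri: "dist p (f t) \<le> dist p (f s) + dist (f s) (f t)" by (rule dist_triangle)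
  \<comment> \<open>The upper bounds for the two distances add up to \<open>t\<close>, which is the
    distance from \<open>p\<close> to \<open>f t\<close>, so both are attained and the triangle
    inequality is an equality.\<close>
  have d: "dist p (f s) = s" "dist (f s) (f t) = t - s" using 1 2 tri eq by auto
  then have "between (p, f t) (f s)" using eq by (simp add: between)
  then obtain c where c: "0 \<le> c" "c \<le> 1" "f s = (1 - c) *\<^sub>R p + c *\<^sub>R f t"
    by (auto simp: between_mem_segment closed_segment_def)
  then have fs: "f s = p + c *\<^sub>R (f t - p)" by (simp add: algebra_simps)
  then have "s = c * t" using d(1) eq c(1) by (simp add: dist_norm norm_minus_commute)
  then show ?thesis using fs t by simp
qed

text \<open>Otherwise replacing the piece up to time \<open>t\<close> by the segment would shorten
  the curve.\<close>

lemma minimal_short_curve_segment: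
  fixes S :: "'a::euclidean_space set"
  assumes f: "short_curve S l p q f" and min: "\<And>k. joined_within S k p q \<Longrightarrow> l \<le> k"
    and t: "0 \<le> t" "t \<le> l" and seg: "closed_segment p (f t) \<subseteq> S"
  shows "dist p (f t) = t"
proof -
  have "joined_within S (l - t) (f t) q"
    using short_curve_piece[OF f t(1,2)] short_curve_ends[OF f] by (auto simp: joined_within_def)
  then have "joined_within S (dist p (f t) + (l - t)) p q"
    using joined_within_trans[OF joined_within_segment[OF seg]] by blast
  then have "l \<le> dist p (f t) + (l - t)" by (rule min)
  moreover have "dist p (f t) \<le> t"
    using short_curve_dist[OF f, of 0 t] short_curve_ends[OF f] t by auto
  ultimately show ?thesis by simp
qed

text \<open>The curve runs straight until it first meets the plane. The last conclusion excludes a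
  return below the plane, so every point below it belongs to this first segment.\<close>

lemma minimal_short_curve_initial_segment:
  fixes S :: "'a::euclidean_space set" and w :: 'a
  assumes f: "short_curve S l p q f" and min: "\<And>k. joined_within S k p q \<Longrightarrow> l \<le> k"
    and p: "w \<bullet> p < c" and q: "c \<le> w \<bullet> q"
    and seg: "\<And>x. x \<in> S \<Longrightarrow> w \<bullet> x < c \<Longrightarrow> closed_segment p x \<subseteq> S"
  obtains t where "0 < t" "t \<le> l" "w \<bullet> f t = c"
    "\<And>s. 0 \<le> s \<Longrightarrow> s \<le> t \<Longrightarrow> f s = p + (s / t) *\<^sub>R (f t - p)"
    "\<And>s. 0 \<le> s \<Longrightarrow> s \<le> l \<Longrightarrow> w \<bullet> f s < c \<Longrightarrow> s < t"
proof -
  note ef = short_curve_ends[OF f]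
  have cont: "continuous_on {0..l} (\<lambda>t. w \<bullet> f t)"
    by (intro continuous_intros short_curve_continuous[OF f])
  define B where "B = {t\<in>{0..l}. c \<le> w \<bullet> f t}"
  have lB: "l \<in> B" using ef q by (auto simp: B_def)
  have "closed ({0..l} \<inter> (\<lambda>t. w \<bullet> f t) -` {c..})"
    by (rule continuous_closed_preimage[OF cont]) auto
  then have "closed B" by (simp add: B_def vimage_def Int_def)
  moreover have bdd: "bdd_below B" by (rule bdd_belowI[of _ 0]) (auto simp: B_def)
  ultimately have "Inf B \<in> B" using lB closed_contains_Inf by blast
  define t where "t = Inf B"
  have t: "t \<in> {0..l}" "c \<le> w \<bullet> f t" using \<open>Inf B \<in> B\<close> by (auto simp: t_def B_def)
  have below: "w \<bullet> f s < c" if "0 \<le> s" "s < t" for s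
  proof (rule ccontr)
    assume "\<not> w \<bullet> f s < c"
    then have "s \<in> B" using that t by (auto simp: B_def)
    then have "t \<le> s" unfolding t_def using bdd by (rule cInf_lower)
    then show False using that by simp
  qed
  have t0: "0 < t" using t p ef by (cases "t = 0") auto
  have straight: "dist p (f s) = s" if "0 \<le> s" "s \<le> l" "w \<bullet> f s < c" for s
    using that short_curve_in[OF f, of s] by (intro minimal_short_curve_segment[OF f min] seg) auto
  \<comment> \<open>Segments to \<open>p\<close> are known to lie in \<open>S\<close> only for
    points strictly below the plane, so the plane is approached from earlier times.\<close>
  define x where "x n = t - t / (real n + 1)" for n
  have x: "0 \<le> x n" "x n < t" for n
    using t0 divide_left_mono[of 1 "real n + 1" t] by (auto simp: x_def)
  have "x \<longlonglongrightarrow> t" unfolding x_def by real_asymp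
  then have fx: "(\<lambda>n. f (x n)) \<longlonglongrightarrow> f t"
  proof (rule continuous_on_tendsto_compose[OF short_curve_continuous[OF f]])
    have "x n \<in> {0..l}" for n using x[of n] t by auto
    then show "\<forall>\<^sub>F n in sequentially. x n \<in> {0..l}" by simp
  qed (use t in auto)
  have "(\<lambda>n. w \<bullet> f (x n)) \<longlonglongrightarrow> w \<bullet> f t" by (intro tendsto_intros fx)
  then have "w \<bullet> f t \<le> c" using below x by (intro Lim_bounded[where M=0]) (auto intro: less_imp_le)
  then have ft: "w \<bullet> f t = c" using t by simp
  have "(\<lambda>n. dist p (f (x n))) \<longlonglongrightarrow> dist p (f t)" by (intro tendsto_intros fx)
  moreover have "dist p (f (x n)) = x n" for n
    using straight[of "x n"] x[of n] below[of "x n"] t by auto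
  ultimately have dt: "dist p (f t) = t" using \<open>x \<longlonglongrightarrow> t\<close> LIMSEQ_unique by auto
  show ?thesis
  proof (rule that[OF t0 _ ft])
    show "t \<le> l" using t by simp
    show "f s = p + (s / t) *\<^sub>R (f t - p)" if "0 \<le> s" "s \<le> t" for s
      using short_curve_straight[OF f t0 _ dt that] t by simp
    \<comment> \<open>After a return below the plane at time \<open>s\<close> the curve would be
      straight up to \<open>s\<close>. Then \<open>f t\<close> would lie between two points strictly
      below the plane, or be one of them, although it lies on the plane.\<close>
    fix s assume s: "0 \<le> s" "s \<le> l" "w \<bullet> f s < c"
    show "s < t"
    proof (rule ccontr)
      assume "\<not> s < t"
      then have ts: "t \<le> s" "0 < s" using t0 by auto
      have "f t = p + (t / s) *\<^sub>R (f s - p)"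
        by (rule short_curve_straight[OF f ts(2) s(2) straight[OF s]]) (use t0 ts in simp_all)
      then have "w \<bullet> f t = w \<bullet> (p + (t / s) *\<^sub>R (f s - p))" by (rule arg_cong)
      also have "\<dots> = (1 - t / s) * (w \<bullet> p) + (t / s) * (w \<bullet> f s)"
        by (simp add: inner_simps algebra_simps)
      also have "\<dots> < (1 - t / s) * c + (t / s) * c"
        using ts t0 s p by (intro add_le_less_mono mult_left_mono mult_strict_left_mono) auto
      finally show False using ft by (simp add: algebra_simps)
    qed
  qed
qed

section \<open>Convex bodies\<close>

lemma supporting_hyperplane_not_interior:
  fixes S :: "'a::euclidean_space set"
  assumes S: "convex S" "x \<in> S" "x \<notin> interior S"
  obtains w where "w \<noteq> 0" "\<And>y. y \<in> S \<Longrightarrow> w \<bullet> x \<le> w \<bullet> y"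
proof (cases "interior S = {}")
  case True
  then obtain w c where w: "w \<noteq> 0" "S \<subseteq> {y. w \<bullet> y = c}"
    using empty_interior_subset_hyperplane[OF S(1)] by metis
  show ?thesis
  proof (rule that[OF w(1)])
    fix y assume "y \<in> S"
    then show "w \<bullet> x \<le> w \<bullet> y" using subsetD[OF w(2) S(2)] subsetD[OF w(2)] by simp
  qed
next
  case False
  then have "x \<notin> rel_interior S" using S(3) by (simp add: interior_rel_interior_gen rel_interior_nonempty_interior)
  then show ?thesis using supporting_hyperplane_rel_boundary[OF S(1,2)] that by metis
qed

lemma not_in_interior_halfspace:
  fixes Q :: "'a::euclidean_space set"
  assumes "\<And>x. x \<in> Q \<Longrightarrow> w \<bullet> x \<le> c" "w \<noteq> 0" "c \<le> w \<bullet> y"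
  shows "y \<notin> interior Q"
proof
  assume "y \<in> interior Q"
  moreover have "interior Q \<subseteq> interior {x. w \<bullet> x \<le> c}" using assms(1) by (intro interior_mono) auto
  ultimately have "w \<bullet> y < c" using assms(2) by (auto simp: interior_halfspace_le)
  then show False using assms(3) by simp
qed

text \<open>The nearest-point projection to a convex body does not increase lengths, so the boundary is
  no worse for travelling than the whole exterior.\<close>

lemma joined_within_frontier:
  fixes Q :: "'a::euclidean_space set"
  assumes Q: "convex Q" "closed Q" "interior Q \<noteq> {}"
    and pq: "p \<in> Q" "q \<in> Q" and J: "joined_within (- interior Q) l p q"
  shows "joined_within (frontier Q) l p q"
proof -
  obtain f where f: "short_curve (- interior Q) l p q f" using J by (auto simp: joined_within_def)
  have ne: "Q \<noteq> {}" using pq by auto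
  have aff: "affine hull Q = UNIV" using Q(3) by (simp add: affine_hull_nonempty_interior)
  have fr: "rel_frontier Q = frontier Q" using aff by (rule rel_frontier_frontier)
  have ri: "rel_interior Q = interior Q" using Q(3) by (rule rel_interior_nonempty_interior)
  have "short_curve (frontier Q) l p q (\<lambda>t. closest_point Q (f t))"
  proof (rule short_curveI)
    fix s t assume "0 \<le> s" "s < t" "t \<le> l"
    then have "dist (f s) (f t) \<le> t - s" using short_curve_dist[OF f, of s t] by simp
    then show "dist (closest_point Q (f s)) (closest_point Q (f t)) \<le> t - s"
      using closest_point_lipschitz[OF Q(1,2) ne] order_trans by blast
  next
    fix t assume "0 \<le> t" "t \<le> l"
    then have "f t \<notin> rel_interior Q" using short_curve_in[OF f, of t] ri by auto
    then show "closest_point Q (f t) \<in> frontier Q"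
      using closest_point_in_rel_frontier[OF Q(2) ne, of "f t"] aff fr by auto
  qed (use short_curve_ends[OF f] pq in \<open>auto simp: closest_point_self\<close>)
  then show ?thesis by (auto simp: joined_within_def)
qed

text \<open>Below the plane \<open>Q\<close> looks like a cone with apex \<open>a\<close>. A point
  \<open>x\<close> there lies on a segment from \<open>a\<close> to some \<open>v\<close> in the
  hull of the other vertices. If some \<open>y\<close> between \<open>a\<close> and \<open>x\<close>
  were interior, then \<open>x\<close>, lying strictly between \<open>y\<close> and
  \<open>v\<close>, would be interior too.\<close>

lemma closed_segment_apex_subset_frontier:
  fixes a :: "'a::euclidean_space"
  assumes V: "finite V" "V \<noteq> {}" "\<And>v. v \<in> V \<Longrightarrow> c \<le> w \<bullet> v"
    and Q: "Q = convex hull (insert a V)" and a: "a \<in> frontier Q"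
    and x: "x \<in> frontier Q" "w \<bullet> x < c"
  shows "closed_segment a x \<subseteq> frontier Q"
proof (cases "x = a")
  case False
  have cvx: "convex Q" and cmp: "compact Q"
    unfolding Q using V(1) by (auto intro: finite_imp_compact_convex_hull)
  have cl: "closure Q = Q" using cmp by (simp add: compact_imp_closed)
  have fr: "frontier Q = Q - interior Q" by (simp add: frontier_def cl)
  have "x \<in> convex hull (insert a V)" using x fr Q by auto
  then obtain u m v where um: "0 \<le> u" "0 \<le> m" "u + m = 1" and v: "v \<in> convex hull V"
    and xe: "x = u *\<^sub>R a + m *\<^sub>R v"
    unfolding convex_hull_insert[OF V(2)] by auto
  have "convex hull V \<subseteq> {y. c \<le> w \<bullet> y}"
    using V(3) by (intro hull_minimal convex_halfspace_ge) auto
  then have "c \<le> w \<bullet> v" using v by auto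
  then have "m \<noteq> 1" using x(2) xe um by auto
  moreover have "m \<noteq> 0" using xe um False by auto
  ultimately have m: "0 < m" "m < 1" using um by auto
  have vQ: "v \<in> Q" using v hull_mono[of V "insert a V" convex] unfolding Q by auto
  show ?thesis
  proof
    fix y assume "y \<in> closed_segment a x"
    then obtain t where t: "0 \<le> t" "t \<le> 1" and y: "y = (1 - t) *\<^sub>R a + t *\<^sub>R x"
      by (auto simp: closed_segment_def)
    have "y \<in> Q" using \<open>y \<in> closed_segment a x\<close> closed_segment_subset[OF _ _ cvx, of a x] a x fr by auto
    moreover have "y \<notin> interior Q"
    proof
      assume yi: "y \<in> interior Q"
      have "t \<noteq> 1"
      proof
        assume "t = 1"
        then have "y = x" by (simp add: y)
        then show False using yi x(1) fr by auto
      qed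
      then have t1: "t < 1" using t by simp
      define k where "k = t * m"
      have k: "k < m" using t1 m by (simp add: k_def)
      \<comment> \<open>\<open>k\<close> and \<open>m\<close> are the positions of \<open>y\<close>
        and \<open>x\<close> on the segment from \<open>a\<close> to \<open>v\<close>;
        \<open>s\<close> is the position of \<open>x\<close> on the segment from \<open>y\<close> to
        \<open>v\<close>.\<close>
      define s where "s = (m - k) / (1 - k)"
      have s: "0 < s" "s < 1" using k m by (auto simp: s_def)
      have "s * (1 - k) = m - k" using k m by (simp add: s_def)
      then have c1: "(1 - s) * (1 - k) = 1 - m" and c2: "(1 - s) * k + s = m"
        by argo+
      have ua: "u = 1 - m" using um by simp
      have yv: "y = (1 - k) *\<^sub>R a + k *\<^sub>R v"
        unfolding y xe ua k_def by (simp add: algebra_simps)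
      have "(1 - s) *\<^sub>R y + s *\<^sub>R v = ((1 - s) * (1 - k)) *\<^sub>R a + ((1 - s) * k + s) *\<^sub>R v"
        unfolding yv scaleR_add_right scaleR_scaleR scaleR_add_left by simp
      then have xs: "x = (1 - s) *\<^sub>R y + s *\<^sub>R v" unfolding c1 c2 xe ua by simp
      have "a \<noteq> v" using xe um False by (metis scaleR_add_left scaleR_one)
      have "y \<noteq> v"
      proof
        assume "y = v"
        then have "(1 - k) *\<^sub>R (a - v) = 0" using yv by (simp add: algebra_simps)
        then show False using k m \<open>a \<noteq> v\<close> by simp
      qed
      then have "x \<in> open_segment y v" using xs s by (auto simp: in_segment)
      then have "x \<in> interior Q"
        using in_interior_closure_convex_segment[OF cvx yi, of v] vQ cl by auto
      then show False using x fr by auto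
    qed
    ultimately show "y \<in> frontier Q" by (simp add: fr)
  qed
qed (use a in auto)

section \<open>Horizontal and vertical coordinates\<close>

text \<open>The horizontal plane becomes the complex plane, so that a quarter turn is multiplication
  by \<open>\<i>\<close> and the cylindrical angle is an argument.\<close>

definition spt :: "complex \<Rightarrow> real \<Rightarrow> real^3" where
  "spt x z = vector [Re x, Im x, z]"

definition hor :: "real^3 \<Rightarrow> complex" where
  "hor p = Complex (p $ 1) (p $ 2)"

lemma hor_spt [simp]: "hor (spt x z) = x" and spt_3 [simp]: "spt x z $ 3 = z"
  by (simp_all add: hor_def spt_def)

lemma spt_hor [simp]: "spt (hor p) (p $ 3) = p"
  by (simp add: spt_def hor_def vec_eq_iff forall_3)

lemma hor_linear [simp]:
  "hor (p + q) = hor p + hor q" "hor (p - q) = hor p - hor q" "hor (c *\<^sub>R p) = c *\<^sub>R hor p" "hor 0 = 0"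
  by (simp_all add: hor_def complex_eq_iff)

lemma spt_add: "spt x z + spt x' z' = spt (x + x') (z + z')"
  and spt_diff: "spt x z - spt x' z' = spt (x - x') (z - z')"
  and spt_scaleR: "c *\<^sub>R spt x z = spt (c *\<^sub>R x) (c * z)"
  by (simp_all add: spt_def vec_eq_iff forall_3)

lemma spt_eq_iff: "spt x z = spt x' z' \<longleftrightarrow> x = x' \<and> z = z'"
  by (metis hor_spt spt_3)

lemma inner_spt: "spt x z \<bullet> p = Re (cnj x * hor p) + z * p $ 3"
  by (simp add: spt_def hor_def inner_vec_def sum_3)

lemma norm_spt: "norm (spt x z) = sqrt ((cmod x)\<^sup>2 + z\<^sup>2)"
  unfolding norm_eq_sqrt_inner[of "spt x z"]
  by (simp add: spt_def inner_vec_def sum_3 cmod_power2) (simp add: power2_eq_square)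

lemma dist_spt: "dist (spt x z) (spt x' z') = sqrt ((cmod (x - x'))\<^sup>2 + (z - z')\<^sup>2)"
  by (simp add: dist_norm spt_diff norm_spt)

lemma continuous_on_hor [continuous_intros]:
  "continuous_on S f \<Longrightarrow> continuous_on S (\<lambda>x. hor (f x))"
  unfolding hor_def Complex_eq by (intro continuous_intros)

text \<open>A leg with horizontal extent d and vertical extent h is longer than h by at most d^2 /
  (2 * h), from sqrt (1 + x) \<le> 1 + x / 2.\<close>

lemma dist_spt_le:
  assumes "(cmod (x - x'))\<^sup>2 \<le> 2 * (z' - z) * e" "z \<le> z'" "0 \<le> e"
  shows "dist (spt x z) (spt x' z') \<le> z' - z + e"
  unfolding dist_spt
proof (rule real_le_lsqrt)
  have "(z' - z + e)\<^sup>2 = (z - z')\<^sup>2 + 2 * (z' - z) * e + e\<^sup>2"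
    by (simp add: power2_eq_square algebra_simps)
  then show "(cmod (x - x'))\<^sup>2 + (z - z')\<^sup>2 \<le> (z' - z + e)\<^sup>2"
    using assms(1) zero_le_power2[of e] by linarith
qed (use assms in auto)

text \<open>The matching lower bound. The factor 1 / 3 instead of the first-order 1 / 2 leaves room
  for the quadratic term.\<close>

lemma dist_spt_ge:
  assumes "c * z \<le> (cmod x)\<^sup>2" "0 \<le> c" "c \<le> 1" "1 \<le> z"
  shows "z + c / 3 \<le> dist (spt 0 0) (spt x z)"
  unfolding dist_spt
proof (rule real_le_rsqrt)
  have "(z + c / 3)\<^sup>2 = z\<^sup>2 + 2 / 3 * (c * z) + c * c / 9"
    by (simp add: power2_eq_square algebra_simps)
  also have "c * c \<le> c * z" using assms by (intro mult_left_mono) auto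
  then have "z\<^sup>2 + 2 / 3 * (c * z) + c * c / 9 \<le> z\<^sup>2 + c * z"
    using mult_nonneg_nonneg[of c z] assms by linarith
  also have "\<dots> \<le> (cmod (0 - x))\<^sup>2 + (0 - z)\<^sup>2" using assms by simp
  finally show "(z + c / 3)\<^sup>2 \<le> (cmod (0 - x))\<^sup>2 + (0 - z)\<^sup>2" .
qed

lemma cnj_ii_power_mult: "cnj (\<i> ^ k) * \<i> ^ (k + d) = \<i> ^ d"
proof -
  have "cnj (\<i> ^ k) * \<i> ^ k = 1"
    by (simp add: power_mult_distrib[symmetric])
  then show ?thesis by (simp add: power_add flip: mult.assoc)
qed

lemma cmod_cnj_ii_power_mult: "cmod (cnj (\<i> ^ k) * \<i> ^ j) = 1"
  by (simp add: norm_mult norm_power)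

text \<open>Inner products of the horizontal directions of vertices \<open>k\<close> and
  \<open>j\<close>. Exact values serve equal and neighbouring indices; for all others the bound 1
  suffices.\<close>

lemma Re_cnj_ii_power_mult:
  shows "\<bar>Re (cnj (\<i> ^ k) * \<i> ^ j)\<bar> \<le> 1"
    and "Re (cnj (\<i> ^ k) * \<i> ^ k) = 1"
    and "Re (cnj (\<i> ^ k) * \<i> ^ Suc k) = 0"
    and "Re (cnj (\<i> ^ Suc k) * \<i> ^ k) = 0"
proof -
  show "\<bar>Re (cnj (\<i> ^ k) * \<i> ^ j)\<bar> \<le> 1"
    using abs_Re_le_cmod[of "cnj (\<i> ^ k) * \<i> ^ j"] unfolding cmod_cnj_ii_power_mult .
  have 0: "cnj (\<i> ^ k) * \<i> ^ k = 1"
    using cnj_ii_power_mult[of k 0] unfolding add_0_right power_0 .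
  have 1: "cnj (\<i> ^ k) * \<i> ^ Suc k = \<i> * (cnj (\<i> ^ k) * \<i> ^ k)" by (simp add: mult_ac)
  have 2: "cnj (\<i> ^ Suc k) * \<i> ^ k = - \<i> * (cnj (\<i> ^ k) * \<i> ^ k)" by simp
  show "Re (cnj (\<i> ^ k) * \<i> ^ k) = 1" "Re (cnj (\<i> ^ k) * \<i> ^ Suc k) = 0"
    "Re (cnj (\<i> ^ Suc k) * \<i> ^ k) = 0"
    unfolding 1 2 unfolding 0 by simp_all
qed

text \<open>Each leg of the exterior route is certified by one plane with the needle on its other
  side.\<close>

lemma joined_within_segment_halfspace:
  fixes Q :: "'a::euclidean_space set"
  assumes "\<And>x. x \<in> Q \<Longrightarrow> w \<bullet> x \<le> c" "w \<noteq> 0" "c \<le> w \<bullet> p" "c \<le> w \<bullet> q" "dist p q \<le> l"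
  shows "joined_within (- interior Q) l p q"
proof -
  have "closed_segment p q \<subseteq> {x. c \<le> w \<bullet> x}"
    using assms by (intro closed_segment_subset convex_halfspace_ge) auto
  then have "closed_segment p q \<subseteq> - interior Q"
    using not_in_interior_halfspace[OF assms(1,2)] by auto
  then show ?thesis using joined_within_segment joined_within_mono assms(5) by blast
qed

section \<open>The needle\<close>

text \<open>\<open>3 \<le> n\<close> provides vertices in all four quarter-turn directions. The
  bound on \<open>M\<close> makes n + 2 legs of excess 64 / M^3 cheaper than the barrier 1 / (6 *
  M).\<close>

locale needle_params =
  fixes M :: real and n :: nat
  assumes n: "3 \<le> n" and M: "400 * (real n + 2) \<le> M"
begin

text \<open>The heights of the \<open>turn k\<close> continue to this value at k = n + 1, so the
  last leg has the same vertical extent as a regular one.\<close>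

definition height :: real where "height = M ^ (2 * n + 3)"

definition foot :: "real^3" where "foot = spt 0 0"

definition tip :: "real^3" where "tip = spt 0 height"

definition vtx :: "nat \<Rightarrow> real^3" where
  "vtx k = spt (of_real (M ^ k) * \<i> ^ k) (M ^ (2 * k))"

definition needle :: "(real^3) set" where
  "needle = convex hull (insert foot (insert tip (vtx ` {..Suc n})))"

lemma M_gt_1: "1 < M" and M_pos: "0 < M" and M_ge: "2000 \<le> M"
proof -
  have "2000 \<le> 400 * (real n + 2)" using n by simp
  then show "2000 \<le> M" using M by linarith
  then show "1 < M" "0 < M" by auto
qed

lemma M_power_pos: "0 < M ^ k" and M_power_mono: "j \<le> k \<Longrightarrow> M ^ j \<le> M ^ k"
  using M_gt_1 by (simp_all add: power_increasing)

lemma M_power_add: "j + k \<le> m \<Longrightarrow> M ^ j * M ^ k \<le> M ^ m"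
  unfolding power_add[symmetric] by (rule M_power_mono)

lemma height_pos: "0 < height" and height_gt: "M ^ (2 * Suc n) < height"
  using M_power_pos power_strict_increasing[of "2 * Suc n" "2 * n + 3" M] M_gt_1
  by (auto simp: height_def)

lemma foot_0: "foot = 0"
  by (simp add: foot_def spt_def vec_eq_iff forall_3)

lemma needle_le:
  assumes "w \<bullet> foot \<le> c" "w \<bullet> tip \<le> c" "\<And>k. k \<le> Suc n \<Longrightarrow> w \<bullet> vtx k \<le> c" "x \<in> needle"
  shows "w \<bullet> x \<le> c"
proof -
  have "needle \<subseteq> {x. w \<bullet> x \<le> c}" unfolding needle_def
    using assms(1-3) by (intro hull_minimal convex_halfspace_le) auto
  then show ?thesis using assms(4) by auto
qed

lemma convex_needle: "convex needle" and compact_needle: "compact needle"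
  and closed_needle: "closed needle" and polytope_needle: "polytope needle"
  unfolding needle_def
  by (auto intro!: compact_imp_closed finite_imp_compact_convex_hull polytope_convex_hull)

lemma foot_in: "foot \<in> needle" and tip_in: "tip \<in> needle"
  and vtx_in: "k \<le> Suc n \<Longrightarrow> vtx k \<in> needle"
  unfolding needle_def by (auto intro!: hull_inc)

lemma frontier_needle: "frontier needle = needle - interior needle"
  using closed_needle by (simp add: frontier_def)

section \<open>The exterior route behind the vertices\<close>

text \<open>The value for which \<open>turn k\<close>, halfway in exponent between vertices
  \<open>k\<close> and \<open>Suc k\<close> and turned away from both, lies on the planes of
  \<open>wall k\<close> and of \<open>wall (Suc k)\<close>.\<close>

definition coef :: "nat \<Rightarrow> real" where "coef k = (M + 1) * M ^ k / M\<^sup>2"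

definition turn :: "nat \<Rightarrow> real^3" where
  "turn k = spt (- of_real (coef k) * (\<i> ^ k + \<i> ^ Suc k)) (M ^ (2 * k + 1))"

text \<open>Outer normal of a plane on the side away from vertex \<open>k\<close>. The tilt is
  chosen so that vertex k + 2, which points to this side, gets the value 0. The offset in
  \<open>needle_wall_le\<close>, equal to M^(k-2), is the distance of vertex k - 2 from the
  axis.\<close>

definition wall :: "nat \<Rightarrow> real^3" where
  "wall k = spt (- (\<i> ^ k)) (- 1 / M ^ (k + 2))"

lemma inner_spt_vtx:
  "spt (- (\<i> ^ k)) z \<bullet> vtx j = - (M ^ j * Re (cnj (\<i> ^ k) * \<i> ^ j)) + z * M ^ (2 * j)"
  unfolding vtx_def inner_spt hor_spt spt_3
proof -
  have 1: "cnj (- (\<i> ^ k)) * (complex_of_real (M ^ j) * \<i> ^ j)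
      = of_real (- (M ^ j)) * (cnj (\<i> ^ k) * \<i> ^ j)" by simp
  have 2: "Re (of_real r * y) = r * Re y" for r y by simp
  show "Re (cnj (- (\<i> ^ k)) * (complex_of_real (M ^ j) * \<i> ^ j)) + z * M ^ (2 * j) =
      - (M ^ j * Re (cnj (\<i> ^ k) * \<i> ^ j)) + z * M ^ (2 * j)"
    unfolding 1 2 by (simp only: mult_minus_left)
qed

lemma inner_spt_turn:
  "spt (- (\<i> ^ k)) z \<bullet> turn k = coef k + z * M ^ (2 * k + 1)"
  "spt (- (\<i> ^ Suc k)) z \<bullet> turn k = coef k + z * M ^ (2 * k + 1)"
proof -
  have *: "Re (cnj (- u) * (- of_real (coef k) * (v + v'))) = coef k * (Re (cnj u * v) + Re (cnj u * v'))" for u v v'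
    by (simp add: algebra_simps)
  show "spt (- (\<i> ^ k)) z \<bullet> turn k = coef k + z * M ^ (2 * k + 1)"
    unfolding turn_def inner_spt hor_spt spt_3 * Re_cnj_ii_power_mult by simp
  show "spt (- (\<i> ^ Suc k)) z \<bullet> turn k = coef k + z * M ^ (2 * k + 1)"
    unfolding turn_def inner_spt hor_spt spt_3 * Re_cnj_ii_power_mult by simp
qed

text \<open>Vertices \<open>k\<close> - 1, \<open>k\<close> and \<open>k\<close> + 1 never point to
  the side away from vertex \<open>k\<close>. Every other vertex is treated as if it pointed there
  exactly.\<close>

lemma opposite_vertex_bound:
  assumes "j \<le> Suc k \<Longrightarrow> k \<le> Suc j \<Longrightarrow> 0 \<le> b" "\<not> (j \<le> Suc k \<and> k \<le> Suc j) \<Longrightarrow> M ^ j \<le> b"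
  shows "- (M ^ j * Re (cnj (\<i> ^ k) * \<i> ^ j)) \<le> b"
proof (cases "j \<le> Suc k \<and> k \<le> Suc j")
  case True
  then consider "j = k" | "j = Suc k" | "k = Suc j" by linarith
  then have "0 \<le> Re (cnj (\<i> ^ k) * \<i> ^ j)"
    by cases (use Re_cnj_ii_power_mult in auto)
  then have "0 \<le> M ^ j * Re (cnj (\<i> ^ k) * \<i> ^ j)" using M_power_pos[of j] by simp
  then show ?thesis using assms(1) True by linarith
next
  case False
  have "M ^ j * (- Re (cnj (\<i> ^ k) * \<i> ^ j)) \<le> M ^ j * 1"
    using Re_cnj_ii_power_mult(1)[of k j] M_power_pos[of j] by (intro mult_left_mono) auto
  then show ?thesis using assms(2) False unfolding mult_minus_right mult_1_right by linarith
qed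

lemma needle_wall_le:
  assumes "x \<in> needle"
  shows "wall k \<bullet> x \<le> M ^ (2 * k) / M ^ (k + 2)"
proof (rule needle_le[OF _ _ _ assms])
  have nonneg: "0 \<le> M ^ (2 * k) / M ^ (k + 2)"
    using divide_pos_pos[OF M_power_pos M_power_pos] by (rule less_imp_le)
  then show "wall k \<bullet> foot \<le> M ^ (2 * k) / M ^ (k + 2)" unfolding foot_0 inner_zero_right .
  have "wall k \<bullet> tip = - (height / M ^ (k + 2))" by (simp add: wall_def tip_def inner_spt)
  also have "\<dots> \<le> 0" using divide_pos_pos[OF height_pos M_power_pos[of "k + 2"]] by linarith
  also note nonneg
  finally show "wall k \<bullet> tip \<le> M ^ (2 * k) / M ^ (k + 2)" .
  fix j assume "j \<le> Suc n"
  have "- (M ^ j * Re (cnj (\<i> ^ k) * \<i> ^ j)) \<le> (M ^ (2 * j) + M ^ (2 * k)) / M ^ (k + 2)"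
  proof (rule opposite_vertex_bound)
    show "0 \<le> (M ^ (2 * j) + M ^ (2 * k)) / M ^ (k + 2)"
      by (intro divide_nonneg_pos add_nonneg_nonneg less_imp_le M_power_pos)
    assume "\<not> (j \<le> Suc k \<and> k \<le> Suc j)"
    \<comment> \<open>Vertices from k + 2 upwards are absorbed by the tilt of the plane, those up to
      k - 2 by its offset.\<close>
    then have "j + (k + 2) \<le> 2 * j \<or> j + (k + 2) \<le> 2 * k" by linarith
    then have "M ^ j * M ^ (k + 2) \<le> M ^ (2 * j) + M ^ (2 * k)"
      using M_power_add[of j "k + 2" "2 * j"] M_power_add[of j "k + 2" "2 * k"]
        M_power_pos[of "2 * j"] M_power_pos[of "2 * k"] by linarith
    then show "M ^ j \<le> (M ^ (2 * j) + M ^ (2 * k)) / M ^ (k + 2)"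
      using M_power_pos by (simp add: pos_le_divide_eq del: power_add power_Suc)
  qed
  then show "wall k \<bullet> vtx j \<le> M ^ (2 * k) / M ^ (k + 2)"
    unfolding wall_def inner_spt_vtx by (simp add: add_divide_distrib)
qed

lemma wall_turn:
  "wall k \<bullet> turn k = M ^ (2 * k) / M ^ (k + 2)"
  "wall (Suc k) \<bullet> turn k = M ^ (2 * Suc k) / M ^ (Suc k + 2)"
  unfolding wall_def inner_spt_turn using M_pos
  by (simp_all add: coef_def field_simps power_add power_mult power2_eq_square)

lemma wall_nonzero: "wall k \<noteq> 0"
proof
  assume "wall k = 0"
  then have "hor (wall k) = 0" by simp
  then show False by (simp add: wall_def)
qed

lemma coef_pos: "0 < coef k" and coef_le: "coef k \<le> 2 * M ^ k / M"
  and coef_ge: "M ^ k / M \<le> coef k"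
  unfolding coef_def using M_gt_1 by (simp_all add: field_simps power2_eq_square add_pos_pos)

lemma cmod_turn: "cmod (hor (turn k)) \<le> 4 * M ^ k / M"
proof -
  have "cmod (\<i> ^ k + \<i> ^ Suc k) \<le> 2"
    using norm_triangle_ineq[of "\<i> ^ k" "\<i> ^ Suc k"] by (simp add: norm_power norm_mult)
  then have "coef k * cmod (\<i> ^ k + \<i> ^ Suc k) \<le> (2 * M ^ k / M) * 2"
    using coef_pos[of k] coef_le[of k] by (intro mult_mono) auto
  then show ?thesis using coef_pos[of k] by (simp add: turn_def norm_mult)
qed

abbreviation excess :: real where "excess \<equiv> 64 / M ^ 3"

text \<open>The numerator 64 of \<open>excess\<close> is the square of the 8 here: a leg moves
  horizontally by at most 8 * M^k, and twice its vertical extent is at least M^(2*k+3).\<close>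

lemma vertical_gap: "(8 * M ^ k)\<^sup>2 \<le> 2 * (M ^ (2 * k + 3) - M ^ (2 * k + 1)) * excess"
proof -
  define X where "X = (M ^ k)\<^sup>2"
  have X: "0 \<le> X" by (simp add: X_def)
  have p: "M ^ (2 * k + 1) = M * X" "M ^ (2 * k + 3) = M ^ 3 * X"
    by (simp_all add: X_def power_add power_even_eq)
  have gap: "2 * (M ^ 3 * X - M * X) * excess = 128 * X - 128 * (X / M\<^sup>2)"
    using M_pos by (simp add: field_simps power2_eq_square power3_eq_cube)
  have "2 \<le> M\<^sup>2" using power_mono[OF M_ge, of 2] by simp
  then have "X / M\<^sup>2 \<le> X / 2" using X by (intro divide_left_mono) auto
  moreover have sq: "(8 * M ^ k)\<^sup>2 = 64 * X" by (simp add: X_def power_mult_distrib)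
  ultimately show ?thesis using X unfolding p gap sq by linarith
qed

lemma dist_foot_turn: "dist foot (turn 0) \<le> M + excess"
proof -
  have "(cmod (0 - hor (turn 0)))\<^sup>2 \<le> (4 * M ^ 0 / M)\<^sup>2"
    using cmod_turn[of 0] by (intro power_mono) auto
  also have "\<dots> \<le> 2 * (M - 0) * excess"
    using M_pos by (simp add: field_simps power2_eq_square power3_eq_cube)
  finally have "dist (spt 0 0) (spt (hor (turn 0)) M) \<le> M - 0 + excess"
    using M_pos by (intro dist_spt_le) auto
  moreover have "spt (hor (turn 0)) M = turn 0" by (simp add: turn_def)
  ultimately show ?thesis by (simp add: foot_def)
qed

lemma dist_turn_turn: "dist (turn k) (turn (Suc k)) \<le> M ^ (2 * k + 3) - M ^ (2 * k + 1) + excess"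
proof -
  have "cmod (hor (turn k) - hor (turn (Suc k))) \<le> 4 * M ^ k / M + 4 * M ^ Suc k / M"
    using norm_triangle_ineq4[of "hor (turn k)" "hor (turn (Suc k))"] cmod_turn[of k] cmod_turn[of "Suc k"]
    by linarith
  also have "4 * M ^ k / M \<le> 4 * M ^ k"
    using M_gt_1 M_power_pos[of k] by (simp add: field_simps)
  finally have "cmod (hor (turn k) - hor (turn (Suc k))) \<le> 8 * M ^ k" using M_pos by simp
  then have "(cmod (hor (turn k) - hor (turn (Suc k))))\<^sup>2 \<le> (8 * M ^ k)\<^sup>2" by (intro power_mono) auto
  also have "\<dots> \<le> 2 * (M ^ (2 * k + 3) - M ^ (2 * k + 1)) * excess" by (rule vertical_gap)
  finally have "dist (spt (hor (turn k)) (M ^ (2 * k + 1))) (spt (hor (turn (Suc k))) (M ^ (2 * k + 3)))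
      \<le> M ^ (2 * k + 3) - M ^ (2 * k + 1) + excess"
    using M_pos M_power_mono[of "2 * k + 1" "2 * k + 3"] by (intro dist_spt_le) auto
  moreover have "spt (hor (turn k)) (M ^ (2 * k + 1)) = turn k"
    "spt (hor (turn (Suc k))) (M ^ (2 * k + 3)) = turn (Suc k)"
    by (simp_all add: turn_def numeral_3_eq_3)
  ultimately show ?thesis by simp
qed

lemma dist_turn_tip: "dist (turn n) tip \<le> height - M ^ (2 * n + 1) + excess"
proof -
  have "(cmod (hor (turn n) - 0))\<^sup>2 \<le> (4 * M ^ n / M)\<^sup>2"
    using cmod_turn[of n] by (intro power_mono) auto
  also have "\<dots> \<le> (8 * M ^ n)\<^sup>2"
    using M_gt_1 M_power_pos[of n] by (intro power_mono) (simp_all add: field_simps)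
  also have "\<dots> \<le> 2 * (height - M ^ (2 * n + 1)) * excess" unfolding height_def by (rule vertical_gap)
  finally have "dist (spt (hor (turn n)) (M ^ (2 * n + 1))) (spt 0 height)
      \<le> height - M ^ (2 * n + 1) + excess"
    using M_pos M_power_mono[of "2 * n + 1" "2 * n + 3"] by (intro dist_spt_le) (auto simp: height_def)
  moreover have "spt (hor (turn n)) (M ^ (2 * n + 1)) = turn n" by (simp add: turn_def)
  ultimately show ?thesis by (simp add: tip_def)
qed

lemma joined_foot_turn0: "joined_within (- interior needle) (M + excess) foot (turn 0)"
\<comment> \<open>The normal is that of \<open>wall 0\<close>, but the plane is moved inwards to
  contain \<open>foot\<close>. This is possible because the offset of a wall serves the vertices two
  or more steps below, and there are none here.\<close>
proof (rule joined_within_segment_halfspace[where w = "spt (- (\<i> ^ 0)) (- 1 / M\<^sup>2)" and c = 0])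
  let ?w = "spt (- (\<i> ^ 0)) (- 1 / M\<^sup>2)"
  fix x assume "x \<in> needle"
  then show "?w \<bullet> x \<le> 0"
  proof (rule needle_le[rotated 3])
    show "?w \<bullet> foot \<le> 0" by (simp add: foot_0)
    show "?w \<bullet> tip \<le> 0" using height_pos by (simp add: tip_def inner_spt)
    fix j assume "j \<le> Suc n"
    have "- (M ^ j * Re (cnj (\<i> ^ 0) * \<i> ^ j)) \<le> M ^ (2 * j) / M\<^sup>2"
    proof (rule opposite_vertex_bound)
      assume "\<not> (j \<le> Suc 0 \<and> 0 \<le> Suc j)"
      then have "M ^ j * M\<^sup>2 \<le> M ^ (2 * j)" by (intro M_power_add) auto
      then show "M ^ j \<le> M ^ (2 * j) / M\<^sup>2" using M_pos by (simp add: pos_le_divide_eq)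
    qed (use M_power_pos in simp)
    then show "?w \<bullet> vtx j \<le> 0" unfolding inner_spt_vtx by simp
  qed
next
  show "spt (- (\<i> ^ 0)) (- 1 / M\<^sup>2) \<noteq> 0"
    by (metis hor_spt hor_linear(4) neg_equal_0_iff_equal power_0 zero_neq_one)
  show "0 \<le> spt (- (\<i> ^ 0)) (- 1 / M\<^sup>2) \<bullet> turn 0"
    unfolding inner_spt_turn using M_pos by (simp add: coef_def field_simps)
qed (use dist_foot_turn in \<open>auto simp: foot_0\<close>)

lemma joined_foot_turn:
  "joined_within (- interior needle) (M ^ (2 * k + 1) + real (k + 1) * excess) foot (turn k)"
proof (induction k)
  case 0
  then show ?case using joined_foot_turn0 by simp
next
  case (Suc k)
  \<comment> \<open>Both turning points lie on the plane of \<open>wall (Suc k)\<close>, which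
    therefore carries the whole leg.\<close>
  have *: "joined_within (- interior needle) (M ^ (2 * k + 3) - M ^ (2 * k + 1) + excess) (turn k) (turn (Suc k))"
    by (rule joined_within_segment_halfspace[OF needle_wall_le[where k = "Suc k"] wall_nonzero])
       (use wall_turn(1)[of "Suc k"] wall_turn(2)[of k] dist_turn_turn[of k] in linarith)+
  have "M ^ (2 * k + 1) + real (k + 1) * e + (M ^ (2 * k + 3) - M ^ (2 * k + 1) + e)
      = M ^ (2 * Suc k + 1) + real (Suc k + 1) * e" for e
    by (simp add: numeral_3_eq_3 algebra_simps)
  from joined_within_trans[OF Suc *, unfolded this] show ?case .
qed

lemma joined_turn_tip:
  "joined_within (- interior needle) (height - M ^ (2 * n + 1) + excess) (turn n) tip"
proof -
  define D where "D = height - M ^ (2 * n + 1)"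
  have D: "0 < D" unfolding D_def height_def
    using power_strict_increasing[of "2 * n + 1" "2 * n + 3" M] M_gt_1 by simp
  \<comment> \<open>The slope for which the plane facing away from the last vertex contains both
    \<open>turn n\<close> and \<open>tip\<close>.\<close>
  define \<kappa> where "\<kappa> = coef n / D"
  have \<kappa>: "0 < \<kappa>" using D coef_pos by (simp add: \<kappa>_def)
  let ?w = "spt (- (\<i> ^ Suc n)) \<kappa>"
  show ?thesis
  proof (rule joined_within_segment_halfspace[where w = ?w and c = "\<kappa> * height"])
    fix x assume "x \<in> needle"
    then show "?w \<bullet> x \<le> \<kappa> * height"
    proof (rule needle_le[rotated 3])
      show "?w \<bullet> foot \<le> \<kappa> * height" using \<kappa> height_pos by (simp add: foot_0)
      show "?w \<bullet> tip \<le> \<kappa> * height" by (simp add: tip_def inner_spt)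
      fix j assume j: "j \<le> Suc n"
      have jh: "M ^ (2 * j) \<le> height" unfolding height_def using j by (intro M_power_mono) auto
      have "- (M ^ j * Re (cnj (\<i> ^ Suc n) * \<i> ^ j)) \<le> \<kappa> * (height - M ^ (2 * j))"
      proof (rule opposite_vertex_bound)
        show "0 \<le> \<kappa> * (height - M ^ (2 * j))" using \<kappa> jh by simp
        assume "\<not> (j \<le> Suc (Suc n) \<and> Suc n \<le> Suc j)"
        then have jn: "Suc j \<le> n" using j by auto
        have "M ^ j * M \<le> M ^ n" using M_power_mono[OF jn] by (simp add: mult.commute)
        then have "M ^ j \<le> M ^ n / M" using M_pos by (simp add: pos_le_divide_eq)
        also have "\<dots> \<le> coef n" by (rule coef_ge)
        also have "\<dots> = \<kappa> * D" using D by (simp add: \<kappa>_def)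
        also have "\<dots> \<le> \<kappa> * (height - M ^ (2 * j))"
          using \<kappa> M_power_mono[of "2 * j" "2 * n + 1"] jn by (intro mult_left_mono) (auto simp: D_def)
        finally show "M ^ j \<le> \<kappa> * (height - M ^ (2 * j))" .
      qed
      then show "?w \<bullet> vtx j \<le> \<kappa> * height" unfolding inner_spt_vtx by (simp add: algebra_simps)
    qed
  next
    show "?w \<noteq> 0" by (metis spt_3 \<kappa> less_irrefl zero_index)
    have "?w \<bullet> turn n = \<kappa> * D + \<kappa> * M ^ (2 * n + 1)"
      unfolding inner_spt_turn using D by (simp add: \<kappa>_def)
    then show "\<kappa> * height \<le> ?w \<bullet> turn n" by (simp add: D_def algebra_simps)
  qed (use dist_turn_tip in \<open>auto simp: tip_def inner_spt\<close>)
qed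

lemma joined_foot_tip:
  obtains l where "joined_within (- interior needle) l foot tip" "l < height + 1 / (6 * M)"
proof
  let ?l = "M ^ (2 * n + 1) + real (n + 1) * excess + (height - M ^ (2 * n + 1) + excess)"
  show "joined_within (- interior needle) ?l foot tip"
    by (rule joined_within_trans[OF joined_foot_turn joined_turn_tip])
  \<comment> \<open>There are n + 2 legs, and 384 = 6 * 64: the total excess stays below 1 / (6 * M)
    as soon as 384 * (n + 2) < M^2.\<close>
  have "384 * (real n + 2) < 400 * (real n + 2)" by simp
  also have "\<dots> \<le> M" by (rule M)
  also have "M \<le> M\<^sup>2" using M_gt_1 by (simp add: power2_eq_square)
  finally have "384 * (real n + 2) * M < M\<^sup>2 * M" using M_pos by (rule mult_strict_right_mono)
  then have "(real n + 2) * excess < 1 / (6 * M)"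
    using M_pos by (simp add: field_simps power2_eq_square power3_eq_cube)
  moreover have "real (n + 1) * e + e = (real n + 2) * e" for e :: real by (simp add: algebra_simps)
  note this[of excess]
  ultimately show "?l < height + 1 / (6 * M)" by linarith
qed

section \<open>The rays that no short path can meet\<close>

lemma axis_in_needle:
  assumes "0 \<le> z" "z \<le> height"
  shows "spt 0 z \<in> needle"
proof -
  have "(1 - z / height) *\<^sub>R foot + (z / height) *\<^sub>R tip \<in> needle"
    using assms height_pos foot_in tip_in by (intro convexD[OF convex_needle]) auto
  then show ?thesis using height_pos by (simp add: foot_0 tip_def spt_scaleR)
qed

text \<open>A supporting plane at an axis point would be parallel to the axis and leave all of the first
  four vertices on one side; but these point into four opposite directions.\<close>

lemma axis_in_interior:
  assumes z: "0 < z" "z < height"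
  shows "spt 0 z \<in> interior needle"
proof (rule ccontr)
  assume "spt 0 z \<notin> interior needle"
  then obtain w where "w \<noteq> 0" and w: "\<And>y. y \<in> needle \<Longrightarrow> w \<bullet> spt 0 z \<le> w \<bullet> y"
    using supporting_hyperplane_not_interior[OF convex_needle axis_in_needle] z
    by (metis less_imp_le)
  have le: "z * w $ 3 \<le> y \<bullet> w" if "y \<in> needle" for y
    using w[OF that] by (simp add: inner_commute[of w] inner_spt)
  have "z * w $ 3 \<le> 0" using le[OF foot_in] by (simp add: foot_0)
  then have "w $ 3 \<le> 0" using z by (simp add: mult_le_0_iff)
  moreover have "z * w $ 3 \<le> height * w $ 3" using le[OF tip_in] by (simp add: tip_def inner_spt)
  then have "0 \<le> (height - z) * w $ 3" by (simp add: algebra_simps)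
  then have "0 \<le> w $ 3" using z by (simp add: zero_le_mult_iff)
  ultimately have w3: "w $ 3 = 0" by simp
  have vk: "0 \<le> Re (cnj (\<i> ^ k) * hor w)" if "k \<le> 3" for k
  proof -
    have "0 \<le> vtx k \<bullet> w" using le[OF vtx_in, of k] that n w3 by simp
    also have "\<dots> = M ^ k * Re (cnj (\<i> ^ k) * hor w)"
      unfolding vtx_def inner_spt w3 by (simp add: algebra_simps)
    finally show ?thesis using M_power_pos[of k] by (simp add: zero_le_mult_iff)
  qed
  have "hor w = 0"
    using vk[of 0] vk[of 1] vk[of 2] vk[of 3] by (simp add: complex_eq_iff power3_eq_cube)
  then have "w = spt 0 0" using spt_hor[of w] w3 by simp
  then show False using \<open>w \<noteq> 0\<close> foot_0 foot_def by simp
qed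

lemma interior_needle_nonempty: "interior needle \<noteq> {}"
  using axis_in_interior[of "height / 2"] height_pos by auto

text \<open>A point nearer to the axis than a point of the needle on the same horizontal ray lies
  strictly between that point and an interior point of the axis, hence in the interior.\<close>

lemma frontier_beyond_ray:
  assumes p: "p \<in> frontier needle" "0 < p $ 3" "p $ 3 < height" and s: "hor p = of_real s * u" "0 \<le> s"
    and ray: "spt (of_real r * u) (p $ 3) \<in> needle"
  shows "r \<le> s"
proof (rule ccontr)
  assume "\<not> r \<le> s"
  then have sr: "s < r" "0 < r" using s by auto
  have pe: "p = spt (of_real s * u) (p $ 3)" using spt_hor[of p] s by simp
  have pi: "p \<notin> interior needle" using p(1) frontier_needle by auto
  have axis: "spt 0 (p $ 3) \<in> interior needle" using axis_in_interior p by auto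
  have "s \<noteq> 0" "u \<noteq> 0" using pe pi axis by auto
  have "(1 - s / r) *\<^sub>R spt 0 (p $ 3) + (s / r) *\<^sub>R spt (of_real r * u) (p $ 3)
      = spt (of_real (s / r * r) * u) ((1 - s / r) * p $ 3 + s / r * p $ 3)"
    by (simp add: spt_scaleR spt_add scaleR_conv_of_real[where 'a = complex])
  also have "\<dots> = p" using sr pe by (simp add: left_diff_distrib)
  finally have "p = (1 - s / r) *\<^sub>R spt 0 (p $ 3) + (s / r) *\<^sub>R spt (of_real r * u) (p $ 3)" by simp
  moreover have "spt 0 (p $ 3) \<noteq> spt (of_real r * u) (p $ 3)"
    using \<open>u \<noteq> 0\<close> sr by (simp add: spt_eq_iff)
  moreover have "0 < s / r" "s / r < 1" using sr s \<open>s \<noteq> 0\<close> by auto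
  ultimately have "p \<in> open_segment (spt 0 (p $ 3)) (spt (of_real r * u) (p $ 3))"
    unfolding in_segment by blast
  then have "p \<in> interior needle"
    using in_interior_closure_convex_segment[OF convex_needle axis, of "spt (of_real r * u) (p $ 3)"]
      ray closure_subset by blast
  then show False using pi by simp
qed

section \<open>The lifted angle of the polygonal line of the vertices\<close>

text \<open>Up to a positive factor and the rotation by \<open>\<i> ^ k\<close>, the complex number
  is the horizontal part of the point at height \<open>z\<close> on the edge from
  \<open>vtx k\<close> to \<open>vtx (Suc k)\<close>. Clamping with \<open>max\<close> freezes the
  angle at 0 below the edge and at a quarter turn above it.\<close>

definition ang :: "nat \<Rightarrow> real \<Rightarrow> real" where
  "ang k z = Arg (Complex (max 0 (M ^ (2 * Suc k) - z) * M ^ k) (max 0 (z - M ^ (2 * k)) * M ^ Suc k))"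

lemma M_power_less: "M ^ (2 * k) < M ^ (2 * Suc k)"
  using M_gt_1 by (intro power_strict_increasing) auto

lemma ang_below:
  assumes "z \<le> M ^ (2 * k)"
  shows "ang k z = 0"
proof -
  have "Complex (max 0 (M ^ (2 * Suc k) - z) * M ^ k) (max 0 (z - M ^ (2 * k)) * M ^ Suc k)
      = of_real ((M ^ (2 * Suc k) - z) * M ^ k)"
    using assms M_power_less[of k] by (auto simp: complex_eq_iff max_def)
  moreover have "0 \<le> (M ^ (2 * Suc k) - z) * M ^ k"
    using assms M_power_less[of k] M_power_pos[of k] by (intro mult_nonneg_nonneg) auto
  ultimately show ?thesis unfolding ang_def by (simp only: Arg_of_real) simp
qed

lemma ang_above:
  assumes "M ^ (2 * Suc k) \<le> z"
  shows "ang k z = pi / 2"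
proof -
  have "Complex (max 0 (M ^ (2 * Suc k) - z) * M ^ k) (max 0 (z - M ^ (2 * k)) * M ^ Suc k)
      = of_real ((z - M ^ (2 * k)) * M ^ Suc k) * \<i>"
    using assms M_power_less[of k] by (auto simp: complex_eq_iff max_def)
  moreover have "0 < (z - M ^ (2 * k)) * M ^ Suc k"
    using assms M_power_less[of k] M_power_pos[of "Suc k"] by (intro mult_pos_pos) auto
  ultimately show ?thesis unfolding ang_def by (simp only: Arg_times_of_real) simp
qed

text \<open>The clamped coordinates are nonnegative and never vanish together, so the point stays in
  the closed first quadrant without 0, off the cut of \<open>Arg\<close>.\<close>

lemma continuous_on_ang: "continuous_on S (ang k)"
  unfolding ang_def
proof (rule continuous_on_Arg')
  show "continuous_on S (\<lambda>z. Complex (max 0 (M ^ (2 * Suc k) - z) * M ^ k) (max 0 (z - M ^ (2 * k)) * M ^ Suc k))"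
    unfolding Complex_eq by (intro continuous_intros)
  fix z
  show "Complex (max 0 (M ^ (2 * Suc k) - z) * M ^ k) (max 0 (z - M ^ (2 * k)) * M ^ Suc k) \<notin> \<real>\<^sub>\<le>\<^sub>0"
  proof (cases "z < M ^ (2 * Suc k)")
    case True
    then have "0 < max 0 (M ^ (2 * Suc k) - z) * M ^ k" using M_power_pos[of k] by simp
    then show ?thesis unfolding complex_nonpos_Reals_iff complex.sel by linarith
  next
    case False
    then have "0 < max 0 (z - M ^ (2 * k)) * M ^ Suc k"
      using M_power_less[of k] M_power_pos[of "Suc k"] by (intro mult_pos_pos) auto
    then show ?thesis unfolding complex_nonpos_Reals_iff complex.sel by linarith
  qed
qed

text \<open>Adding the clamped quarter turns of the n + 1 edges gives a continuous lift directly,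
  whereas \<open>Arg\<close> of the polygonal line would jump in every full turn.\<close>

definition angle :: "real \<Rightarrow> real" where
  "angle z = (\<Sum>k\<le>n. ang k z)"

lemma continuous_on_angle: "continuous_on S angle"
  unfolding angle_def by (intro continuous_on_sum continuous_on_ang)

lemma angle_low: "z \<le> 1 \<Longrightarrow> angle z = 0"
  unfolding angle_def using M_gt_1
  by (intro sum.neutral ballI ang_below) (auto intro: order_trans[OF _ one_le_power])

lemma angle_high:
  assumes "M ^ (2 * Suc n) \<le> z"
  shows "angle z = real (Suc n) * (pi / 2)"
proof -
  have "angle z = (\<Sum>k\<le>n. pi / 2)" unfolding angle_def
  proof (rule sum.cong[OF refl], rule ang_above)
    fix k assume "k \<in> {..n}"
    then have "M ^ (2 * Suc k) \<le> M ^ (2 * Suc n)" by (intro M_power_mono) auto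
    then show "M ^ (2 * Suc k) \<le> z" using assms by linarith
  qed
  then show ?thesis by simp
qed

lemma angle_mid:
  assumes k: "k \<le> n" and z: "M ^ (2 * k) \<le> z" "z \<le> M ^ (2 * Suc k)"
  shows "angle z = real k * (pi / 2) + ang k z"
proof -
  have "{..n} = {..<k} \<union> {k} \<union> {k<..n}" using k by auto
  moreover have "(\<Sum>j\<in>{..<k} \<union> {k} \<union> {k<..n}. ang j z)
      = (\<Sum>j\<in>{..<k} \<union> {k}. ang j z) + (\<Sum>j\<in>{k<..n}. ang j z)"
    by (rule sum.union_disjoint) auto
  moreover have "(\<Sum>j\<in>{..<k} \<union> {k}. ang j z) = (\<Sum>j<k. ang j z) + (\<Sum>j\<in>{k}. ang j z)"
    by (rule sum.union_disjoint) auto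
  ultimately have "angle z = (\<Sum>j<k. ang j z) + ang k z + (\<Sum>j\<in>{k<..n}. ang j z)"
    unfolding angle_def by simp
  moreover have "(\<Sum>j<k. ang j z) = (\<Sum>j<k. pi / 2)"
  proof (rule sum.cong[OF refl], rule ang_above)
    fix j assume "j \<in> {..<k}"
    then have "M ^ (2 * Suc j) \<le> M ^ (2 * k)" by (intro M_power_mono) auto
    then show "M ^ (2 * Suc j) \<le> z" using z by linarith
  qed
  moreover have "(\<Sum>j\<in>{k<..n}. ang j z) = 0"
  proof (rule sum.neutral, rule ballI, rule ang_below)
    fix j assume "j \<in> {k<..n}"
    then have "M ^ (2 * Suc k) \<le> M ^ (2 * j)" by (intro M_power_mono) auto
    then show "z \<le> M ^ (2 * j)" using z by linarith
  qed
  ultimately show ?thesis by simp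
qed

lemma cis_quarter_turns: "cis (real k * (pi / 2)) = \<i> ^ k"
  by (metis Complex.DeMoivre cis_pi_half)

section \<open>Points of the needle on the rays\<close>

lemma ray_low:
  assumes "0 \<le> z" "z \<le> 1"
  shows "spt (of_real z * cis (angle z)) z \<in> needle"
proof -
  have "(1 - z) *\<^sub>R foot + z *\<^sub>R vtx 0 \<in> needle"
    using assms foot_in vtx_in[of 0] by (intro convexD[OF convex_needle]) auto
  then show ?thesis using angle_low[OF assms(2)]
    by (simp add: foot_0 vtx_def spt_scaleR scaleR_conv_of_real[where 'a = complex])
qed

lemma ray_high:
  assumes "M ^ (2 * Suc n) \<le> z" "z \<le> height"
  shows "spt (of_real ((height - z) / (height - M ^ (2 * Suc n)) * M ^ Suc n) * cis (angle z)) z \<in> needle"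
proof -
  define T where "T = M ^ (2 * Suc n)"
  define c where "c = (height - z) / (height - T)"
  have T: "0 < height - T" using height_gt by (simp add: T_def)
  have c: "0 \<le> c" "c \<le> 1" using assms T by (auto simp: c_def T_def)
  have zc: "(1 - c) * height + c * T = z"
  proof -
    have "c * (height - T) = height - z" using T by (simp add: c_def)
    then show ?thesis by (simp add: algebra_simps)
  qed
  have "(1 - c) *\<^sub>R tip + c *\<^sub>R vtx (Suc n) \<in> needle"
    using c tip_in vtx_in[of "Suc n"] by (intro convexD[OF convex_needle]) auto
  also have "(1 - c) *\<^sub>R tip + c *\<^sub>R vtx (Suc n) = spt (of_real (c * M ^ Suc n) * \<i> ^ Suc n) z"
    unfolding tip_def vtx_def spt_scaleR spt_add zc[symmetric] T_def
    by (simp add: scaleR_conv_of_real[where 'a = complex] mult.assoc)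
  finally show ?thesis
    unfolding angle_high[OF assms(1)] cis_quarter_turns c_def T_def .
qed

text \<open>The witness is the point at height \<open>z\<close> on an edge. Its horizontal
  coordinates along the directions of the two end vertices are \<open>A / D\<close> and
  \<open>B / D\<close>, and r^2 / z is at least 2 * M / (M + 1)^2, which is at least 1 / (2 *
  M).\<close>

lemma ray_mid:
  assumes k: "k \<le> n" and z: "M ^ (2 * k) \<le> z" "z \<le> M ^ (2 * Suc k)"
  obtains r where "0 < r" "z / (2 * M) \<le> r\<^sup>2" "spt (of_real r * cis (angle z)) z \<in> needle"
proof -
  define X A B D where "X = M ^ k" and "A = (M ^ (2 * Suc k) - z) * M ^ k"
    and "B = (z - M ^ (2 * k)) * M ^ Suc k" and "D = M ^ (2 * Suc k) - M ^ (2 * k)"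
  define w where "w = Complex A B"
  have X: "0 < X" and D: "0 < D" using M_power_pos M_power_less by (auto simp: X_def D_def)
  have AB: "0 \<le> A" "0 \<le> B" unfolding A_def B_def
    using z M_power_pos[of k] M_power_pos[of "Suc k"] by (auto intro!: mult_nonneg_nonneg)
  have pw: "M ^ (2 * k) = X\<^sup>2" "M ^ (2 * Suc k) = X\<^sup>2 * M\<^sup>2"
    by (simp_all add: X_def power_even_eq power_mult_distrib power2_eq_square)
  have z0: "0 < z" using z(1) M_power_pos[of "2 * k"] by linarith
  have sum: "A + B = X * (M - 1) * (z + X\<^sup>2 * M)"
    unfolding A_def B_def pw by (simp add: X_def algebra_simps power2_eq_square)
  have Dm: "D = X\<^sup>2 * ((M - 1) * (M + 1))"
    unfolding D_def pw by (simp add: algebra_simps power2_eq_square)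
  \<comment> \<open>The AM-GM inequality for \<open>z\<close> and the geometric mean
    \<open>X\<^sup>2 * M\<close> of the end heights turns the factored \<open>A + B\<close> into a
    bound proportional to \<open>z\<close>.\<close>
  have "4 * (z * (X\<^sup>2 * M)) \<le> (z + X\<^sup>2 * M)\<^sup>2"
    using zero_le_power2[of "z - X\<^sup>2 * M"] by (simp add: power2_eq_square algebra_simps)
  then have 1: "(X * (M - 1))\<^sup>2 * (4 * (z * (X\<^sup>2 * M))) \<le> (A + B)\<^sup>2"
    unfolding sum power_mult_distrib by (intro mult_left_mono) auto
  have "(M + 1)\<^sup>2 \<le> (2 * M)\<^sup>2" using M_gt_1 by (intro power_mono) auto
  then have "(z / M) * (X\<^sup>2 * (M - 1))\<^sup>2 * (M + 1)\<^sup>2 \<le> (z / M) * (X\<^sup>2 * (M - 1))\<^sup>2 * (2 * M)\<^sup>2"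
    using z0 M_pos by (intro mult_left_mono) auto
  also have "\<dots> = (X * (M - 1))\<^sup>2 * (4 * (z * (X\<^sup>2 * M)))"
    using M_pos by (simp add: field_simps power2_eq_square)
  also note 1
  also have "(A + B)\<^sup>2 \<le> 2 * (A\<^sup>2 + B\<^sup>2)"
    using zero_le_power2[of "A - B"] by (simp add: power2_eq_square algebra_simps)
  also have "(z / M) * (X\<^sup>2 * (M - 1))\<^sup>2 * (M + 1)\<^sup>2 = (z / M) * D\<^sup>2"
    unfolding Dm by (simp add: power_mult_distrib)
  finally have *: "z / M * D\<^sup>2 \<le> 2 * (A\<^sup>2 + B\<^sup>2)" .
  have "z / (2 * M) * D\<^sup>2 = z / M * D\<^sup>2 / 2" by simp
  also have "\<dots> \<le> 2 * (A\<^sup>2 + B\<^sup>2) / 2" using * by (rule divide_right_mono) simp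
  also have "\<dots> = A\<^sup>2 + B\<^sup>2" by simp
  finally have "z / (2 * M) * D\<^sup>2 \<le> A\<^sup>2 + B\<^sup>2" .
  moreover have "A\<^sup>2 + B\<^sup>2 = (cmod w)\<^sup>2" by (simp add: w_def cmod_power2)
  ultimately have len: "z / (2 * M) \<le> (cmod w / D)\<^sup>2"
    using D by (simp add: power_divide pos_le_divide_eq)
  have "0 < z / (2 * M)" using z0 M_pos by simp
  then have "cmod w / D \<noteq> 0" using len by auto
  then have w0: "w \<noteq> 0" by auto
  have "ang k z = Arg w"
    using z by (simp add: ang_def w_def A_def B_def max_def)
  then have "cis (angle z) = \<i> ^ k * sgn w"
    unfolding angle_mid[OF k z] cis_mult[symmetric] cis_quarter_turns using w0 by (simp add: cis_Arg)
  then have "of_real (cmod w / D) * cis (angle z) = (1 / D) *\<^sub>R (\<i> ^ k * w)"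
    using w0 by (simp add: sgn_div_norm scaleR_conv_of_real[where 'a = complex])
  moreover have "spt ((1 / D) *\<^sub>R (\<i> ^ k * w)) z \<in> needle"
  proof -
    define c where "c = (z - M ^ (2 * k)) / D"
    have cD: "c * D = z - M ^ (2 * k)" using D by (simp add: c_def)
    have "(1 - c) * D = M ^ (2 * Suc k) - z"
      unfolding left_diff_distrib cD by (simp add: D_def)
    then have c1: "1 - c = (M ^ (2 * Suc k) - z) / D" using D by (simp add: nonzero_eq_divide_eq)
    have c: "0 \<le> c" "0 \<le> 1 - c" unfolding c1 using z D by (auto simp: c_def)
    have "(1 - c) *\<^sub>R vtx k + c *\<^sub>R vtx (Suc k) \<in> needle"
      using c k vtx_in by (intro convexD[OF convex_needle]) auto
    moreover have "(1 - c) * M ^ (2 * k) + c * M ^ (2 * Suc k) = z"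
      using cD by (simp add: D_def algebra_simps)
    moreover have "(1 - c) *\<^sub>R (of_real (M ^ k) * \<i> ^ k) + c *\<^sub>R (of_real (M ^ Suc k) * \<i> ^ Suc k)
        = (1 / D) *\<^sub>R (\<i> ^ k * w)"
    proof -
      have e: "(1 - c) * M ^ k = A / D" "c * M ^ Suc k = B / D"
        unfolding c1 unfolding c_def A_def B_def by (simp_all only: times_divide_eq_left)
      have r: "x *\<^sub>R (of_real y * v) = of_real (x * y) * v" for x y and v :: complex
        by (simp add: scaleR_conv_of_real[where 'a = complex])
      show ?thesis unfolding r e w_def Complex_eq
        by (simp add: scaleR_conv_of_real[where 'a = complex] add_divide_distrib distrib_left mult_ac)
    qed
    ultimately show ?thesis unfolding vtx_def spt_scaleR spt_add by simp
  qed
  ultimately show ?thesis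
    using that[of "cmod w / D"] len w0 D by simp
qed

lemma height_interval:
  assumes "1 \<le> z" "z \<le> M ^ (2 * Suc m)"
  obtains k where "k \<le> m" "M ^ (2 * k) \<le> z" "z \<le> M ^ (2 * Suc k)"
  using assms
proof (induction m arbitrary: thesis)
  case 0
  then show ?case using 0(1)[of 0] by simp
next
  case (Suc m)
  show ?case
  proof (cases "z \<le> M ^ (2 * Suc m)")
    case True
    then obtain k where "k \<le> m" "M ^ (2 * k) \<le> z" "z \<le> M ^ (2 * Suc k)"
      using Suc.IH Suc.prems by metis
    then show ?thesis using Suc.prems(1)[of k] by simp
  next
    case False
    then show ?thesis using Suc.prems(1)[of "Suc m"] Suc.prems(3) by simp
  qed
qed

section \<open>The spiralling number of a shortest path\<close>

lemma needle_3:
  assumes "x \<in> needle"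
  shows "0 \<le> x $ 3" "x $ 3 \<le> height"
proof -
  have vz: "M ^ (2 * k) \<le> height" if "k \<le> Suc n" for k
    unfolding height_def using that by (intro M_power_mono) auto
  have "spt 0 (-1) \<bullet> x \<le> 0"
    by (rule needle_le[OF _ _ _ assms])
       (use height_pos M_power_pos in \<open>auto simp: foot_0 tip_def vtx_def inner_spt less_imp_le\<close>)
  then show "0 \<le> x $ 3" by (simp add: inner_spt)
  have "spt 0 1 \<bullet> x \<le> height"
    by (rule needle_le[OF _ _ _ assms])
       (use height_pos vz in \<open>auto simp: foot_0 tip_def vtx_def inner_spt simp del: power_Suc\<close>)
  then show "x $ 3 \<le> height" by (simp add: inner_spt)
qed

lemma spt_0_1_nonzero: "spt 0 1 \<noteq> 0" "spt 0 (-1) \<noteq> 0"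
  by (metis spt_3 zero_index zero_neq_one, metis spt_3 zero_index zero_neq_neg_one)

lemma foot_frontier: "foot \<in> frontier needle"
  and tip_frontier: "tip \<in> frontier needle"
proof -
  have "foot \<notin> interior needle"
    by (rule not_in_interior_halfspace[where w = "spt 0 (-1)" and c = 0])
       (use needle_3 spt_0_1_nonzero in \<open>auto simp: inner_spt foot_0\<close>)
  moreover have "tip \<notin> interior needle"
    by (rule not_in_interior_halfspace[where w = "spt 0 1" and c = height])
       (use needle_3 spt_0_1_nonzero in \<open>auto simp: inner_spt tip_def\<close>)
  ultimately show "foot \<in> frontier needle" "tip \<in> frontier needle"
    using foot_in tip_in frontier_needle by auto
qed

text \<open>All vertices other than \<open>foot\<close> have height at least 1, so below that height
  the needle is a cone with apex \<open>foot\<close>.\<close>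

lemma foot_segment:
  assumes "x \<in> frontier needle" "x $ 3 < 1"
  shows "closed_segment foot x \<subseteq> frontier needle"
proof (rule closed_segment_apex_subset_frontier[where V = "insert tip (vtx ` {..Suc n})" and w = "spt 0 1" and c = 1])
  show "1 \<le> spt 0 1 \<bullet> v" if "v \<in> insert tip (vtx ` {..Suc n})" for v
    using that M_gt_1 by (auto simp: inner_spt tip_def vtx_def height_def simp del: power_Suc)
  show "foot \<in> frontier needle" by (rule foot_frontier)
qed (use assms in \<open>auto simp: needle_def inner_spt\<close>)

lemma tip_segment:
  assumes "x \<in> frontier needle" "M ^ (2 * Suc n) < x $ 3"
  shows "closed_segment tip x \<subseteq> frontier needle"
proof (rule closed_segment_apex_subset_frontier[where V = "insert foot (vtx ` {..Suc n})" and w = "spt 0 (-1)" and c = "- (M ^ (2 * Suc n))"])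
  show "- (M ^ (2 * Suc n)) \<le> spt 0 (-1) \<bullet> v" if "v \<in> insert foot (vtx ` {..Suc n})" for v
    using that M_power_pos[of "2 * Suc n"]
    by (auto simp: inner_spt foot_def vtx_def intro!: M_power_mono simp del: power_Suc mult_Suc_right)
  show "needle = convex hull (insert tip (insert foot (vtx ` {..Suc n})))"
    by (simp add: needle_def insert_commute)
  show "tip \<in> frontier needle" by (rule tip_frontier)
qed (use assms in \<open>auto simp: inner_spt\<close>)

section \<open>Shape of a minimal curve of small excess\<close>

context
  fixes l :: real and f :: "real \<Rightarrow> real^3"
  assumes f: "short_curve (frontier needle) l foot tip f"
    and minimal: "\<And>k. joined_within (frontier needle) k foot tip \<Longrightarrow> l \<le> k"
    and short: "l < height + 1 / (6 * M)"
begin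

text \<open>A point further out would already cost 1 / (6 * M) more than its height on the way from
  \<open>foot\<close>, and the way on to \<open>tip\<close> takes at least the remaining
  height.\<close>

lemma close_to_axis:
  assumes t: "0 \<le> t" "t \<le> l" and z: "1 \<le> f t $ 3"
  shows "(cmod (hor (f t)))\<^sup>2 < f t $ 3 / (2 * M)"
proof (rule ccontr)
  assume "\<not> (cmod (hor (f t)))\<^sup>2 < f t $ 3 / (2 * M)"
  then have "1 / (2 * M) * (f t $ 3) \<le> (cmod (hor (f t)))\<^sup>2" by simp
  then have "f t $ 3 + 1 / (2 * M) / 3 \<le> dist (spt 0 0) (spt (hor (f t)) (f t $ 3))"
    using M_gt_1 z by (intro dist_spt_ge) auto
  then have "f t $ 3 + 1 / (6 * M) \<le> dist foot (f t)" by (simp add: foot_def)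
  also have "\<dots> \<le> t"
    using short_curve_dist[OF f, of 0 t] short_curve_ends[OF f] t by simp
  finally have 1: "f t $ 3 + 1 / (6 * M) \<le> t" .
  have "height - f t $ 3 \<le> dist (f t) tip"
    using component_le_norm_cart[of "f t - tip" 3] by (simp add: tip_def dist_norm)
  also have "\<dots> \<le> l - t"
    using short_curve_dist[OF f, of t l] short_curve_ends[OF f] t by simp
  finally show False using 1 short by linarith
qed

lemma bottom_segment:
  obtains t where "0 < t" "t \<le> l" "f t $ 3 = 1"
    "\<And>s. 0 \<le> s \<Longrightarrow> s \<le> t \<Longrightarrow> f s = (s / t) *\<^sub>R f t"
    "\<And>s. 0 \<le> s \<Longrightarrow> s \<le> l \<Longrightarrow> f s $ 3 < 1 \<Longrightarrow> s < t"
proof -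
  obtain t where t: "0 < t" "t \<le> l" "spt 0 1 \<bullet> f t = 1"
    "\<And>s. 0 \<le> s \<Longrightarrow> s \<le> t \<Longrightarrow> f s = foot + (s / t) *\<^sub>R (f t - foot)"
    "\<And>s. 0 \<le> s \<Longrightarrow> s \<le> l \<Longrightarrow> spt 0 1 \<bullet> f s < 1 \<Longrightarrow> s < t"
  proof (rule minimal_short_curve_initial_segment[OF f minimal, of "spt 0 1" 1])
    show "spt 0 1 \<bullet> foot < 1" by (simp add: foot_0)
    show "1 \<le> spt 0 1 \<bullet> tip" using M_gt_1 by (simp add: inner_spt tip_def height_def)
    show "closed_segment foot x \<subseteq> frontier needle"
      if "x \<in> frontier needle" "spt 0 1 \<bullet> x < 1" for x
      using foot_segment that by (simp add: inner_spt)
  qed metis+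
  show ?thesis
  proof (rule that[OF t(1,2)])
    show "f t $ 3 = 1" using t(3) by (simp add: inner_spt)
    show "f s = (s / t) *\<^sub>R f t" if "0 \<le> s" "s \<le> t" for s
      using t(4)[OF that] by (simp add: foot_0)
    show "s < t" if "0 \<le> s" "s \<le> l" "f s $ 3 < 1" for s
      using t(5)[OF that(1,2)] that(3) by (simp add: inner_spt)
  qed
qed

lemma top_segment:
  obtains t where "0 \<le> t" "t < l" "f t $ 3 = M ^ (2 * Suc n)"
    "\<And>s. t \<le> s \<Longrightarrow> s \<le> l \<Longrightarrow> f s = tip + ((l - s) / (l - t)) *\<^sub>R (f t - tip)"
    "\<And>s. 0 \<le> s \<Longrightarrow> s \<le> l \<Longrightarrow> M ^ (2 * Suc n) < f s $ 3 \<Longrightarrow> t < s"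
proof -
  define T where "T = M ^ (2 * Suc n)"
  have T: "0 < T" "T < height" unfolding T_def by (rule M_power_pos, rule height_gt)
  obtain u where u: "0 < u" "u \<le> l" "spt 0 (-1) \<bullet> f (l - u) = - T"
    "\<And>s. 0 \<le> s \<Longrightarrow> s \<le> u \<Longrightarrow> f (l - s) = tip + (s / u) *\<^sub>R (f (l - u) - tip)"
    "\<And>s. 0 \<le> s \<Longrightarrow> s \<le> l \<Longrightarrow> spt 0 (-1) \<bullet> f (l - s) < - T \<Longrightarrow> s < u"
  \<comment> \<open>The reversed curve starts at \<open>tip\<close>, and its negated height plays
    the role of the coordinate that grows up to the plane.\<close>
  proof (rule minimal_short_curve_initial_segment[OF short_curve_reverse[OF f], of "spt 0 (-1)" "- T"])
    show "l \<le> k" if "joined_within (frontier needle) k tip foot" for k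
      using minimal joined_within_reverse[OF that] by blast
    show "closed_segment tip x \<subseteq> frontier needle"
      if "x \<in> frontier needle" "spt 0 (-1) \<bullet> x < - T" for x
      using tip_segment that by (simp add: inner_spt T_def del: power_Suc mult_Suc_right)
    show "spt 0 (-1) \<bullet> tip < - T" using T by (simp add: inner_spt tip_def)
    show "- T \<le> spt 0 (-1) \<bullet> foot" using T by (simp add: foot_0)
  qed metis+
  show ?thesis
  proof (rule that[of "l - u"])
    show "f (l - u) $ 3 = M ^ (2 * Suc n)" using u(3) by (simp add: inner_spt T_def del: power_Suc mult_Suc_right)
    show "f s = tip + ((l - s) / (l - (l - u))) *\<^sub>R (f (l - u) - tip)" if "l - u \<le> s" "s \<le> l" for s
      using u(4)[of "l - s"] that by simp
    show "l - u < s" if "0 \<le> s" "s \<le> l" "M ^ (2 * Suc n) < f s $ 3" for s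
      using u(5)[of "l - s"] that by (simp add: inner_spt T_def del: power_Suc mult_Suc_right)
  qed (use u(1,2) in auto)
qed

lemma off_ray:
  assumes t: "0 \<le> t" "t \<le> l" and ne: "f t \<noteq> foot" "f t \<noteq> tip"
  shows "0 < f t $ 3 \<and> f t $ 3 < height \<and> (\<forall>r\<ge>0. hor (f t) \<noteq> of_real r * cis (angle (f t $ 3)))"
proof -
  define T where "T = M ^ (2 * Suc n)"
  have T: "1 \<le> T" "T < height" using M_gt_1 height_gt by (auto simp: T_def simp del: power_Suc mult_Suc_right)
  obtain u where u: "0 < u" "u \<le> l" "f u $ 3 = 1"
    "\<And>s. 0 \<le> s \<Longrightarrow> s \<le> u \<Longrightarrow> f s = (s / u) *\<^sub>R f u"
    "\<And>s. 0 \<le> s \<Longrightarrow> s \<le> l \<Longrightarrow> f s $ 3 < 1 \<Longrightarrow> s < u"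
    using bottom_segment by metis
  obtain v where v: "0 \<le> v" "v < l" "f v $ 3 = T"
    "\<And>s. v \<le> s \<Longrightarrow> s \<le> l \<Longrightarrow> f s = tip + ((l - s) / (l - v)) *\<^sub>R (f v - tip)"
    "\<And>s. 0 \<le> s \<Longrightarrow> s \<le> l \<Longrightarrow> T < f s $ 3 \<Longrightarrow> v < s"
    using top_segment unfolding T_def by metis
  define z where "z = f t $ 3"
  have fr: "f t \<in> frontier needle" using short_curve_in[OF f, of t] t by simp
  consider "z < 1" | "1 \<le> z" "z \<le> T" | "T < z" by linarith
  then show ?thesis
  proof cases
    case 1
    then have tu: "t < u" using u(5)[OF t] by (simp add: z_def)
    have ft: "f t = (t / u) *\<^sub>R f u" by (rule u(4)[OF t(1) less_imp_le[OF tu]])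
    then have zt: "z = t / u" using u(3) by (simp add: z_def)
    have "t \<noteq> 0" using short_curve_ends[OF f] ne by auto
    then have z0: "0 < z" using zt t u(1) by simp
    have "hor (f t) \<noteq> of_real r * cis (angle (f t $ 3))" if r: "0 \<le> r" for r
    proof
      assume eq: "hor (f t) = of_real r * cis (angle (f t $ 3))"
      then have "z \<le> r"
        using frontier_beyond_ray[OF fr _ _ eq r, of z] ray_low[of z] z0 1 T by (simp add: z_def)
      moreover have "hor (f t) = z *\<^sub>R hor (f u)" using ft zt by simp
      then have "r = z * cmod (hor (f u))"
        using eq r z0 by (metis abs_of_nonneg less_imp_le mult.right_neutral norm_cis norm_mult norm_of_real norm_scaleR)
      ultimately have "1 \<le> cmod (hor (f u))" using z0 by simp
      then have "1 \<le> (cmod (hor (f u)))\<^sup>2" by simp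
      moreover have "1 / (2 * M) < 1" using M_gt_1 by simp
      ultimately show False using close_to_axis[of u] u(1-3) by simp
    qed
    then show ?thesis using z0 1 T by (auto simp: z_def)
  next
    case 2
    obtain k where k: "k \<le> n" "M ^ (2 * k) \<le> z" "z \<le> M ^ (2 * Suc k)"
      using height_interval[of z n] 2 unfolding T_def by metis
    obtain r0 where r0: "0 < r0" "z / (2 * M) \<le> r0\<^sup>2" "spt (of_real r0 * cis (angle z)) z \<in> needle"
      using ray_mid[OF k] by metis
    have "hor (f t) \<noteq> of_real r * cis (angle (f t $ 3))" if r: "0 \<le> r" for r
    proof
      assume eq: "hor (f t) = of_real r * cis (angle (f t $ 3))"
      then have "r0 \<le> r"
        using frontier_beyond_ray[OF fr _ _ eq r, of r0] r0(3) 2 T by (simp add: z_def)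
      then have "r0\<^sup>2 \<le> r\<^sup>2" using r0(1) by (intro power_mono) auto
      moreover have "(cmod (hor (f t)))\<^sup>2 = r\<^sup>2" unfolding eq by (simp add: norm_mult)
      ultimately show False using close_to_axis[OF t] 2 r0(2) by (simp add: z_def)
    qed
    then show ?thesis using 2 T by (auto simp: z_def)
  next
    case 3
    then have vt: "v < t" using v(5)[OF t] by (simp add: z_def)
    define c where "c = (l - t) / (l - v)"
    have ft: "f t = tip + c *\<^sub>R (f v - tip)" 
      unfolding c_def by (rule v(4)[OF less_imp_le[OF vt] t(2)])
    have "t \<noteq> l" using short_curve_ends[OF f] ne by auto
    then have c0: "0 < c" using t v(2) by (simp add: c_def)
    have zt: "height - z = c * (height - T)"
      using arg_cong[OF ft, of "\<lambda>x. x $ 3"] v(3) by (simp add: z_def tip_def algebra_simps)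
    have zh: "z < height" using mult_pos_pos[OF c0, of "height - T"] zt T by simp
    have cq: "(height - z) / (height - T) = c" using zt T by simp
    have "hor (f t) \<noteq> of_real r * cis (angle (f t $ 3))" if r: "0 \<le> r" for r
    proof
      assume eq: "hor (f t) = of_real r * cis (angle (f t $ 3))"
      have "spt (of_real (c * M ^ Suc n) * cis (angle z)) z \<in> needle"
        using ray_high[folded T_def, OF less_imp_le[OF 3] less_imp_le[OF zh]] unfolding cq .
      then have "c * M ^ Suc n \<le> r"
        using frontier_beyond_ray[OF fr _ _ eq r, of "c * M ^ Suc n"] 3 zh T
        by (simp add: z_def del: power_Suc)
      moreover have "hor (f t) = c *\<^sub>R hor (f v)" using ft by (simp add: tip_def)
      then have "r = c * cmod (hor (f v))"
        using eq r c0 by (metis abs_of_nonneg less_imp_le mult.right_neutral norm_cis norm_mult norm_of_real norm_scaleR)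
      ultimately have "M ^ Suc n \<le> cmod (hor (f v))" using c0 by simp
      then have "(M ^ Suc n)\<^sup>2 \<le> (cmod (hor (f v)))\<^sup>2"
        using M_power_pos[of "Suc n"] by (intro power_mono) auto
      then have "T \<le> (cmod (hor (f v)))\<^sup>2" by (simp only: T_def power_even_eq)
      moreover have "T / (2 * M) \<le> T / 1" using M_gt_1 T by (intro divide_left_mono) auto
      ultimately show False using close_to_axis[of v] v(1-3) T by simp
    qed
    then show ?thesis using 3 zh T by (auto simp: z_def)
  qed
qed

text \<open>The lifted angle in full turns, measured from the forbidden ray; it jumps only on that ray.\<close>

definition turns :: "real^3 \<Rightarrow> real" where
  "turns x = (angle (x $ 3) + pi + Arg (- hor x * cis (- angle (x $ 3)))) / (2 * pi)"

text \<open>Rotating by minus the angle of the line and negating carries the forbidden ray onto the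
  nonpositive reals, where \<open>Arg\<close> is discontinuous.\<close>

lemma off_ray_Arg:
  assumes "0 \<le> t" "t \<le> l" "f t \<noteq> foot" "f t \<noteq> tip"
  shows "- hor (f t) * cis (- angle (f t $ 3)) \<notin> \<real>\<^sub>\<le>\<^sub>0" "hor (f t) \<noteq> 0"
proof -
  show "hor (f t) \<noteq> 0" using off_ray[OF assms] by force
  define y where "y = - hor (f t) * cis (- angle (f t $ 3))"
  have "y \<notin> \<real>\<^sub>\<le>\<^sub>0"
  proof
    assume "y \<in> \<real>\<^sub>\<le>\<^sub>0"
    then obtain r where r: "r \<le> 0" "y = of_real r" by (auto elim!: nonpos_Reals_cases)
    have "hor (f t) = - y * cis (angle (f t $ 3))"
      by (simp add: y_def cis_mult mult.assoc)
    also have "\<dots> = of_real (- r) * cis (angle (f t $ 3))" unfolding r(2) by simp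
    finally show False using off_ray[OF assms] r(1) by (metis neg_0_le_iff_le)
  qed
  then show "- hor (f t) * cis (- angle (f t $ 3)) \<notin> \<real>\<^sub>\<le>\<^sub>0" unfolding y_def .
qed

text \<open>The summand \<open>pi\<close> in \<open>turns\<close> undoes the negation inside
  \<open>Arg\<close>.\<close>

lemma hor_turns:
  assumes "hor x \<noteq> 0"
  shows "hor x = of_real (cmod (hor x)) * cis (2 * pi * turns x)"
proof -
  define y where "y = - hor x * cis (- angle (x $ 3))"
  have y: "y \<noteq> 0" "cmod y = cmod (hor x)" using assms by (auto simp: y_def norm_mult)
  have "2 * pi * turns x = Arg y + (angle (x $ 3) + pi)" by (simp add: turns_def y_def)
  then have "of_real (cmod (hor x)) * cis (2 * pi * turns x)
      = (of_real (cmod y) * cis (Arg y)) * (cis (angle (x $ 3)) * cis pi)"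
    unfolding y(2) by (simp add: cis_mult[symmetric] mult.assoc)
  also have "of_real (cmod y) * cis (Arg y) = y"
    using y(1) by (simp add: cis_Arg sgn_div_norm scaleR_conv_of_real[where 'a = complex])
  also have "y * (cis (angle (x $ 3)) * cis pi) = hor x"
    by (simp add: y_def cis_mult mult.assoc)
  finally show ?thesis by simp
qed

lemma continuous_on_turns:
  "continuous_on (f ` {0..l} - {foot, tip}) turns"
proof -
  let ?S = "f ` {0..l} - {foot, tip}"
  have h: "continuous_on ?S hor"
    using continuous_on_hor[OF continuous_on_id] by simp
  have a: "continuous_on ?S (\<lambda>x. angle (x $ 3))"
    by (intro continuous_on_compose2[OF continuous_on_angle[of UNIV]] continuous_intros) auto
  have "continuous_on ?S (\<lambda>x. Arg (- hor x * cis (- angle (x $ 3))))"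
  proof (rule continuous_on_Arg')
    show "continuous_on ?S (\<lambda>x. - hor x * cis (- angle (x $ 3)))"
      by (intro continuous_intros h a)
    show "- hor x * cis (- angle (x $ 3)) \<notin> \<real>\<^sub>\<le>\<^sub>0" if "x \<in> ?S" for x
    proof -
      from that obtain t where "0 \<le> t" "t \<le> l" "f t \<noteq> foot" "f t \<noteq> tip" "x = f t" by auto
      then show ?thesis using off_ray_Arg(1) by (simp only:)
    qed
  qed
  then show ?thesis unfolding turns_def
    by (intro continuous_on_divide continuous_on_add continuous_on_const a) auto
qed

lemma has_spiralling_number_shortest:
  obtains s where "has_spiralling_number (\<lambda>t. f (l * t)) s" "real (Suc n) / 4 - 1 \<le> s"
proof -
  define T where "T = M ^ (2 * Suc n)"
  have T: "1 \<le> T" "T < height" using M_gt_1 height_gt by (auto simp: T_def simp del: power_Suc mult_Suc_right)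
  define P where "P = f ` {0..l} - {foot, tip}"
  note sp = short_curve_path[OF f]
  obtain u where u: "0 < u" "u \<le> l" "f u $ 3 = 1"
    "\<And>s. 0 \<le> s \<Longrightarrow> s \<le> u \<Longrightarrow> f s = (s / u) *\<^sub>R f u"
    "\<And>s. 0 \<le> s \<Longrightarrow> s \<le> l \<Longrightarrow> f s $ 3 < 1 \<Longrightarrow> s < u"
    using bottom_segment by metis
  obtain v where v: "0 \<le> v" "v < l" "f v $ 3 = T"
    "\<And>s. v \<le> s \<Longrightarrow> s \<le> l \<Longrightarrow> f s = tip + ((l - s) / (l - v)) *\<^sub>R (f v - tip)"
    "\<And>s. 0 \<le> s \<Longrightarrow> s \<le> l \<Longrightarrow> T < f s $ 3 \<Longrightarrow> v < s"
    using top_segment unfolding T_def by metis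
  \<comment> \<open>\<open>\<alpha>\<close> and \<open>\<beta>\<close> are the values of
    \<open>turns\<close> near the two ends. There \<open>angle\<close> is constant and the curve is
    a segment from a point of the axis, so the direction of its horizontal part is constant as
    well.\<close>
  define \<alpha> where "\<alpha> = (pi + Arg (- hor (f u))) / (2 * pi)"
  define \<Theta> where "\<Theta> = real (Suc n) * (pi / 2)"
  define \<beta> where "\<beta> = (\<Theta> + pi + Arg (- hor (f v) * cis (- \<Theta>))) / (2 * pi)"
  have low: "turns x = \<alpha>" if x: "x \<in> P" "x $ 3 < 1" for x
  proof -
    obtain s where s: "0 \<le> s" "s \<le> l" "x = f s" "x \<noteq> foot" using x by (auto simp: P_def)
    have su: "s < u" by (rule u(5)[OF s(1,2)]) (use s x in simp)
    have xs: "x = (s / u) *\<^sub>R f u" unfolding s(3) by (rule u(4)[OF s(1) less_imp_le[OF su]])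
    have "s \<noteq> 0" using s short_curve_ends[OF f] by auto
    then have "0 < s / u" using s u(1) by simp
    moreover have "- hor x = of_real (s / u) * - hor (f u)"
      unfolding xs by (simp add: scaleR_conv_of_real[where 'a = complex])
    ultimately have "Arg (- hor x) = Arg (- hor (f u))" by (simp only: Arg_times_of_real)
    then show ?thesis unfolding turns_def \<alpha>_def using angle_low[of "x $ 3"] x by simp
  qed
  have high: "turns x = \<beta>" if x: "x \<in> P" "T < x $ 3" for x
  proof -
    obtain s where s: "0 \<le> s" "s \<le> l" "x = f s" "x \<noteq> tip" using x by (auto simp: P_def)
    have vs: "v < s" by (rule v(5)[OF s(1,2)]) (use s x in simp)
    have xs: "x = tip + ((l - s) / (l - v)) *\<^sub>R (f v - tip)"
      unfolding s(3) by (rule v(4)[OF less_imp_le[OF vs] s(2)])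
    have "s \<noteq> l" using s short_curve_ends[OF f] by auto
    then have "0 < (l - s) / (l - v)" using s v(2) by simp
    moreover have "- hor x * cis (- \<Theta>) = of_real ((l - s) / (l - v)) * (- hor (f v) * cis (- \<Theta>))"
      unfolding xs by (simp add: tip_def scaleR_conv_of_real[where 'a = complex])
    ultimately have "Arg (- hor x * cis (- \<Theta>)) = Arg (- hor (f v) * cis (- \<Theta>))"
      by (simp only: Arg_times_of_real)
    moreover have "angle (x $ 3) = \<Theta>"
      unfolding \<Theta>_def by (rule angle_high) (use x T_def in auto)
    ultimately show ?thesis unfolding turns_def \<beta>_def by simp
  qed
  have sgn_axis: "sgn (tip - foot) = axis 3 1"
  proof -
    have tf: "tip - foot = height *\<^sub>R axis 3 1"
      by (simp add: foot_0 tip_def spt_def vec_eq_iff forall_3 axis_def)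
    show ?thesis unfolding tf using height_pos by (simp add: sgn_scaleR sgn_div_norm)
  qed
  have frame: "orthonormal_frame (axis 1 1) (axis 2 1) (axis 3 1)"
    by (simp add: orthonormal_frame_def inner_axis_axis)
  have cyl: "cylindrical_coords foot (axis 1 1) (axis 2 1) (axis 3 1) x (2 * pi * turns x)
      (cmod (hor x)) (x $ 3)" if xP: "x \<in> P" for x
  proof -
    obtain s where s: "0 \<le> s" "s \<le> l" "x = f s" "x \<noteq> foot" "x \<noteq> tip"
      using xP unfolding P_def by fastforce
    then have h: "hor x \<noteq> 0" using off_ray_Arg(2) by auto
    have "x $ 1 = Re (hor x)" "x $ 2 = Im (hor x)" by (simp_all add: hor_def)
    then have "x $ 1 = cmod (hor x) * cos (2 * pi * turns x)" "x $ 2 = cmod (hor x) * sin (2 * pi * turns x)"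
      using arg_cong[OF hor_turns[OF h], of Re] arg_cong[OF hor_turns[OF h], of Im] by simp_all
    then show ?thesis
      using h by (simp add: cylindrical_coords_def foot_0 vec_eq_iff forall_3 axis_def)
  qed
  have c3: "((\<lambda>x. x $ 3) \<longlongrightarrow> a $ 3) (at a within P)" for a :: "real^3"
    by (intro tendsto_vec_nth tendsto_ident_at)
  have "\<forall>\<^sub>F x in at foot within P. x $ 3 < 1"
    using c3[of foot] by (rule order_tendstoD) (simp add: foot_0)
  then have ea: "\<forall>\<^sub>F x in at foot within P. turns x = \<alpha>"
    by (rule eventually_mp[rotated]) (use low in \<open>auto simp: eventually_at_filter\<close>)
  have "\<forall>\<^sub>F x in at tip within P. T < x $ 3"
    using c3[of tip] by (rule order_tendstoD) (use T in \<open>simp add: tip_def\<close>)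
  then have eb: "\<forall>\<^sub>F x in at tip within P. turns x = \<beta>"
    by (rule eventually_mp[rotated]) (use high in \<open>auto simp: eventually_at_filter\<close>)
  have "\<forall>\<^sub>F p in (at foot within P) \<times>\<^sub>F (at tip within P).
      (case p of (x, y) \<Rightarrow> \<bar>turns x - turns y\<bar>) = \<bar>\<alpha> - \<beta>\<bar>"
    using eventually_prodI[OF ea eb] by (rule eventually_mono) auto
  then have lim: "((\<lambda>(x, y). \<bar>turns x - turns y\<bar>) \<longlongrightarrow> \<bar>\<alpha> - \<beta>\<bar>)
      ((at foot within P) \<times>\<^sub>F (at tip within P))"
    by (rule tendsto_eventually)
  have "foot \<noteq> tip" using height_pos by (simp add: foot_def tip_def spt_eq_iff)
  have "has_spiralling_number (\<lambda>t. f (l * t)) \<bar>\<alpha> - \<beta>\<bar>"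
    unfolding has_spiralling_number_def Let_def sp sgn_axis P_def[symmetric]
    by (intro conjI exI[of _ "axis 1 1"] exI[of _ "axis 2 1"] exI[of _ turns]
        exI[of _ "\<lambda>x. cmod (hor x)"] exI[of _ "\<lambda>x. x $ 3"] ballI)
       (fact frame continuous_on_turns[folded P_def] cyl lim \<open>foot \<noteq> tip\<close>)+
  moreover have "real (Suc n) / 4 - 1 \<le> \<bar>\<alpha> - \<beta>\<bar>"
  proof -
    \<comment> \<open>The line turns by \<open>\<Theta>\<close>. The two \<open>Arg\<close> values
      lie in an interval of length 2 * pi, so comparing the curve with the line loses at most one
      full turn.\<close>
    have "\<Theta> - 2 * pi \<le> \<Theta> + Arg (- hor (f v) * cis (- \<Theta>)) - Arg (- hor (f u))"
      using Arg_bounded[of "- hor (f v) * cis (- \<Theta>)"] Arg_bounded[of "- hor (f u)"] by linarith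
    then have "(\<Theta> - 2 * pi) / (2 * pi) \<le> \<beta> - \<alpha>"
      unfolding \<alpha>_def \<beta>_def diff_divide_distrib[symmetric] by (intro divide_right_mono) auto
    moreover have "(\<Theta> - 2 * pi) / (2 * pi) = real (Suc n) / 4 - 1"
      by (simp add: \<Theta>_def field_simps)
    ultimately show ?thesis by linarith
  qed
  ultimately show ?thesis by (rule that)
qed

end

lemma shortest_path_spirals:
  obtains P s where "shortest_path_in (frontier needle) P" "has_spiralling_number P s"
    "real (Suc n) / 4 - 1 \<le> s"
proof -
  obtain l0 where l0: "joined_within (- interior needle) l0 foot tip" "l0 < height + 1 / (6 * M)"
    by (rule joined_foot_tip)
  have J: "joined_within (frontier needle) l0 foot tip"
    by (rule joined_within_frontier[OF convex_needle closed_needle interior_needle_nonempty foot_in tip_in l0(1)])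
  have "compact (frontier needle)" by (rule compact_frontier[OF compact_needle])
  from joined_within_minimal[OF this J] obtain l f where f: "short_curve (frontier needle) l foot tip f"
    and min: "\<And>k. joined_within (frontier needle) k foot tip \<Longrightarrow> l \<le> k" by metis
  have "l < height + 1 / (6 * M)" using min[OF J] l0(2) by linarith
  from has_spiralling_number_shortest[OF f min this] obtain s where
    "has_spiralling_number (\<lambda>t. f (l * t)) s" "real (Suc n) / 4 - 1 \<le> s" by metis
  then show ?thesis
    using that shortest_path_in_minimal_short_curve[OF f min] by blast
qed

end

theorem theorem3:
  fixes n :: int
  shows "\<exists>(Q :: (real^3) set) P s.
           polytope Q \<and> interior Q \<noteq> {} \<and>
           shortest_path_in (frontier Q) P \<and>
           has_spiralling_number P s \<and> s \<ge> of_int n"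
proof -
  \<comment> \<open>For nonnegative \<open>n\<close>, the m + 1 quarter turns less the lost full
    turn amount to exactly \<open>n\<close>; the summand 3 also secures the bound
    \<open>3 \<le> m\<close> in the locale.\<close>
  define m where "m = nat (4 * n) + 3"
  interpret needle_params "400 * (real m + 2)" m
    by standard (auto simp: m_def)
  obtain P s where "shortest_path_in (frontier needle) P" "has_spiralling_number P s"
    and s: "real (Suc m) / 4 - 1 \<le> s"
    by (rule shortest_path_spirals)
  moreover have "of_int n \<le> real (Suc m) / 4 - 1"
    unfolding m_def by (cases "0 \<le> n") (auto simp: add_divide_distrib)
  ultimately show ?thesis
    using polytope_needle interior_needle_nonempty order_trans by blast
qed

end
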